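(* Let $\mathcal{C}$ be a polytopal complex in $\mathbb{R}^d$ all of whose faces are compressed lattice polytopes, and let $\mathcal{C}'\subset\mathcal{C}$ be any subcomplex. Then, for any field $\mathbb{K}$, there exist a finite set $V$ and abstract simplicial complexes $\Delta'\subset\Delta$ on $V$ such that for all $k\in\mathbb{Z}_{>0}$ \[ \mathcal{L}_{\bigcup\mathcal{C}\setminus\bigcup\mathcal{C}'}(k) = \mathcal{H}_{I_{\Delta/\Delta'}}(k), \] and this function of $k$ is a polynomial in $k$.
   Context: A polytopal complex is a finite collection $\mathcal{C}$ of polytopes in $\mathbb{R}^d$ closed under taking faces and such that any two of its members intersect in a common face; $\bigcup\mathcal{C}$ is the union of its members, and a subcomplex is a subset that is itself a polytopal complex. A lattice polytope has all vertices in $\mathbb{Z}^d$. For $A\subset\mathbb{R}^d$, the Ehrhart function is $\mathcal{L}_A(k)=|\mathbb{Z}^d\cap kA|$. A $d$-simplex is unimodular if it is lattice isomorphic (via an affine isomorphism restricting to a bijection of $\mathbb{Z}^d$) to the convex hull of $d+1$ standard unit vectors. For a total order $\prec$ on the lattice points of a lattice polytope $P$, the pulling triangulation $\mathrm{pull}(P,\prec)$ is defined recursively: if $P$ is a simplex whose only lattice points are its vertices, it is the complex generated by $P$; otherwise it is the complex generated by the simplices $\mathrm{conv}\{v,G\}$, where $v$ is the $\prec$-minimal lattice point of $P$, $F$ ranges over faces of $P$ not containing $v$, and $G$ ranges over $\mathrm{pull}(F,\prec)$. A lattice polytope $P$ is compressed if for every total order $\prec$ the pulling triangulation $\mathrm{pull}(P,\prec)$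 consists of unimodular simplices. For an abstract simplicial complex $\Delta$ on a finite set $V$, identify $V$ with the variables of $\mathbb{K}[x]=\mathbb{K}[x_v:v\in V]$ (standard grading). The Stanley–Reisner ideal is $I_\Delta=\langle x^u : \mathrm{supp}(u)\notin\Delta\rangle$ and $\mathbb{K}[\Delta]=\mathbb{K}[x]/I_\Delta$. For a subcomplex $\Delta'\subset\Delta$, the relative Stanley–Reisner ideal $I_{\Delta/\Delta'}$ is the ideal of $\mathbb{K}[\Delta]$ generated by the monomials $x^u$ with $\mathrm{supp}(u)\notin\Delta'$; its Hilbert function $\mathcal{H}_{I_{\Delta/\Delta'}}(k)$ equals the number of monomials $x^u$ of degree $k$ with $\mathrm{supp}(u)\in\Delta\setminus\Delta'$. *)

theory Defs
  imports
    "HOL-Analysis.Analysis"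
    "HOL-Algebra.QuotRing"
    "HOL-Algebra.Embedded_Algebras"
    "HOL-Library.Poly_Mapping"
begin

section \<open>Polytopal complexes and Ehrhart functions\<close>

text \<open>The empty set counts as a polytope and as a face of every polytope (it is a
  \<open>face_of\<close> every convex set), so every nonempty complex contains it, and disjoint members
  meet in a common face.\<close>

definition polytopal_complex :: "'a::euclidean_space set set \<Rightarrow> bool" where
  "polytopal_complex C \<longleftrightarrow>
     finite C \<and>
     (\<forall>P\<in>C. polytope P) \<and>
     (\<forall>P\<in>C. \<forall>F. F face_of P \<longrightarrow> F \<in> C) \<and>
     (\<forall>P\<in>C. \<forall>Q\<in>C. (P \<inter> Q) face_of P \<and> (P \<inter> Q) face_of Q)"

definition subcomplex :: "'a::euclidean_space set set \<Rightarrow> 'a set set \<Rightarrow> bool" where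
  "subcomplex C' C \<longleftrightarrow> C' \<subseteq> C \<and> polytopal_complex C'"

definition int_lattice :: "(real ^ 'd) set" where
  "int_lattice = {x. \<forall>i. x $ i \<in> \<int>}"

definition lattice_polytope :: "(real ^ 'd) set \<Rightarrow> bool" where
  "lattice_polytope P \<longleftrightarrow> polytope P \<and> {x. x extreme_point_of P} \<subseteq> int_lattice"

definition ehrhart :: "(real ^ 'd) set \<Rightarrow> nat \<Rightarrow> nat" where
  "ehrhart A k = card (int_lattice \<inter> (\<lambda>x. real k *\<^sub>R x) ` A)"

section \<open>Compressed polytopes\<close>

text \<open>A polytope need not be full-dimensional and may live in a different space than its
  image, so affine isomorphisms are taken between the affine hulls, and lattice points are
  those lying in the affine hulls.  Every affine map on an affine hull extends to the ambient
  space, where it is a linear map plus a constant.\<close>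

definition lattice_isomorphic :: "(real ^ 'd) set \<Rightarrow> (real ^ 'e) set \<Rightarrow> bool" where
  "lattice_isomorphic P Q \<longleftrightarrow>
     (\<exists>f g c. linear g \<and> f = (\<lambda>x. g x + c) \<and>
        bij_betw f (affine hull P) (affine hull Q) \<and>
        bij_betw f (affine hull P \<inter> int_lattice) (affine hull Q \<inter> int_lattice) \<and>
        f ` P = Q)"

text \<open>A simplex in \<open>d\<close>-space has at most \<open>d + 1\<close> vertices, so the index type
  \<open>'d option\<close>, with \<open>d + 1\<close> elements, supplies enough standard unit vectors.\<close>

definition unimodular_simplex :: "(real ^ 'd) set \<Rightarrow> bool" where
  "unimodular_simplex S \<longleftrightarrow>
     (\<exists>n (J :: 'd option set). n simplex S \<and> int (card J) = n + 1 \<and>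
        lattice_isomorphic S (convex hull ((\<lambda>j. axis j 1 :: real ^ ('d option)) ` J)))"

definition empty_simplex :: "(real ^ 'd) set \<Rightarrow> bool" where
  "empty_simplex P \<longleftrightarrow> (\<exists>n. n simplex P) \<and> P \<inter> int_lattice = {x. x extreme_point_of P}"

text \<open>\<open>in_pull r P S\<close> says that \<open>S\<close> belongs to the pulling triangulation of \<open>P\<close>, where
  \<open>(x, y) \<in> r\<close> means that \<open>x\<close> precedes or equals \<open>y\<close>.  The recursion descends to faces that
  avoid a point of \<open>P\<close>, i.e. to proper faces, so it is well-founded and the least solution is
  the only one.  Passing to all faces of the generating simplices gives the complex that they
  generate.\<close>

inductive in_pull :: "((real ^ 'd) \<times> (real ^ 'd)) set \<Rightarrow> (real ^ 'd) set \<Rightarrow> (real ^ 'd) set \<Rightarrow> bool"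
  for r where
  simplex: "empty_simplex P \<Longrightarrow> S face_of P \<Longrightarrow> in_pull r P S"
| pull: "\<not> empty_simplex P \<Longrightarrow>
    v \<in> P \<inter> int_lattice \<Longrightarrow> (\<forall>w \<in> P \<inter> int_lattice. (v, w) \<in> r) \<Longrightarrow>
    F face_of P \<Longrightarrow> v \<notin> F \<Longrightarrow> in_pull r F G \<Longrightarrow>
    S face_of (convex hull (insert v G)) \<Longrightarrow> in_pull r P S"

definition pulling_triangulation ::
    "(real ^ 'd) set \<Rightarrow> ((real ^ 'd) \<times> (real ^ 'd)) set \<Rightarrow> (real ^ 'd) set set" where
  "pulling_triangulation P r = {S. in_pull r P S}"

definition compressed :: "(real ^ 'd) set \<Rightarrow> bool" where
  "compressed P \<longleftrightarrow> lattice_polytope P \<and>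
     (\<forall>r. linear_order_on (P \<inter> int_lattice) r \<longrightarrow>
        (\<forall>S \<in> pulling_triangulation P r. unimodular_simplex S))"

section \<open>Relative Stanley--Reisner ideals\<close>

definition abstract_simplicial_complex :: "'v set \<Rightarrow> 'v set set \<Rightarrow> bool" where
  "abstract_simplicial_complex V \<Delta> \<longleftrightarrow>
     \<Delta> \<subseteq> Pow V \<and> (\<forall>\<sigma>\<in>\<Delta>. \<forall>\<tau>. \<tau> \<subseteq> \<sigma> \<longrightarrow> \<tau> \<in> \<Delta>)"

text \<open>An exponent vector is a finitely supported map \<open>'v \<Rightarrow>\<^sub>0 nat\<close>, its support being \<open>keys\<close>;
  a polynomial is a finitely supported map from exponent vectors to coefficients.\<close>

type_synonym ('v, 'k) mpoly = "('v \<Rightarrow>\<^sub>0 nat) \<Rightarrow>\<^sub>0 'k"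

definition monomial_degree :: "('v \<Rightarrow>\<^sub>0 nat) \<Rightarrow> nat" where
  "monomial_degree u = (\<Sum>v\<in>Poly_Mapping.keys u. Poly_Mapping.lookup u v)"

definition monomial :: "('v \<Rightarrow>\<^sub>0 nat) \<Rightarrow> ('v, 'k::field) mpoly" where
  "monomial u = Poly_Mapping.single u 1"

definition poly_ring :: "'v set \<Rightarrow> ('v, 'k::field) mpoly ring" where
  "poly_ring V = \<lparr>carrier = {p. \<forall>u\<in>Poly_Mapping.keys p. Poly_Mapping.keys u \<subseteq> V},
     monoid.mult = (*), one = 1, zero = 0, add = (+)\<rparr>"

definition SR_ideal :: "'v set \<Rightarrow> 'v set set \<Rightarrow> ('v, 'k::field) mpoly set" where
  "SR_ideal V \<Delta> =
     genideal (poly_ring V)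
       {monomial u | u. Poly_Mapping.keys u \<subseteq> V \<and> Poly_Mapping.keys u \<notin> \<Delta>}"

definition SR_ring :: "'v set \<Rightarrow> 'v set set \<Rightarrow> ('v, 'k::field) mpoly set ring" where
  "SR_ring V \<Delta> = poly_ring V Quot SR_ideal V \<Delta>"

definition SR_class :: "'v set \<Rightarrow> 'v set set \<Rightarrow> ('v, 'k::field) mpoly \<Rightarrow> ('v, 'k) mpoly set" where
  "SR_class V \<Delta> p = SR_ideal V \<Delta> +>\<^bsub>poly_ring V\<^esub> p"

definition relative_SR_ideal ::
    "'v set \<Rightarrow> 'v set set \<Rightarrow> 'v set set \<Rightarrow> ('v, 'k::field) mpoly set set" where
  "relative_SR_ideal V \<Delta> \<Delta>' =
     genideal (SR_ring V \<Delta>)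
       {SR_class V \<Delta> (monomial u) | u. Poly_Mapping.keys u \<subseteq> V \<and> Poly_Mapping.keys u \<notin> \<Delta>'}"

definition SR_scalars :: "'v set \<Rightarrow> 'v set set \<Rightarrow> ('v, 'k::field) mpoly set set" where
  "SR_scalars V \<Delta> = range (\<lambda>c. SR_class V \<Delta> (Poly_Mapping.single 0 c))"

definition SR_graded_part :: "'v set \<Rightarrow> 'v set set \<Rightarrow> nat \<Rightarrow> ('v, 'k::field) mpoly set set" where
  "SR_graded_part V \<Delta> k =
     SR_class V \<Delta> ` {p \<in> carrier (poly_ring V). \<forall>u\<in>Poly_Mapping.keys p. monomial_degree u = k}"

text \<open>The Hilbert function of a homogeneous ideal \<open>I\<close> of the Stanley--Reisner ring: the
  dimension over the ground field (embedded as \<open>SR_scalars\<close>) of the part of degree \<open>k\<close>.\<close>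

definition hilbert_function ::
    "'v set \<Rightarrow> 'v set set \<Rightarrow> ('v, 'k::field) mpoly set set \<Rightarrow> nat \<Rightarrow> nat" where
  "hilbert_function V \<Delta> I k =
     ring.dim (SR_ring V \<Delta>) (SR_scalars V \<Delta>) (I \<inter> SR_graded_part V \<Delta> k)"

end

theory Submission
  imports Defs
begin

text \<open>Fix a total order on the lattice points.  The pulling triangulations of the faces of the
  complex agree on common faces: a face of a polytope carries exactly those simplices that are
  contained in it.  Moreover every point of a polytope \<open>P\<close> lies in the relative interior of exactly one
  simplex, which is found by projecting the point away from the least lattice point \<open>v\<close> of \<open>P\<close> onto
  a face that avoids \<open>v\<close>, and recursing.  So the triangulations glue to a triangulation \<open>\<Delta>\<close> of the
  whole complex, with the subcomplex triangulated by \<open>\<Delta>'\<close>.  As all simplices are unimodular,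
  for \<open>k > 0\<close> a lattice point in the \<open>k\<close>-th dilate is a combination of the vertices of exactly
  one simplex with positive integral coefficients summing to \<open>k\<close>, that is, a monomial of degree \<open>k\<close>
  whose support is a face of \<open>\<Delta>\<close>, and the point avoids the subcomplex iff the support is not
  in \<open>\<Delta>'\<close>.  These monomials form a basis of the degree \<open>k\<close> part of the relative ideal.\<close>

section \<open>Vertex sets of pulling triangulations\<close>

definition least_lattice_point ::
    "((real ^ 'd) \<times> (real ^ 'd)) set \<Rightarrow> (real ^ 'd) set \<Rightarrow> real ^ 'd \<Rightarrow> bool" where
  "least_lattice_point r P v \<longleftrightarrow> v \<in> P \<inter> int_lattice \<and> (\<forall>w \<in> P \<inter> int_lattice. (v, w) \<in> r)"

text \<open>The pulling triangulation in terms of vertex sets.  The empty simplices need no separate clause: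
  pulling such a simplex again only reproduces its faces.\<close>

inductive pull_vertices ::
    "((real ^ 'd) \<times> (real ^ 'd)) set \<Rightarrow> (real ^ 'd) set \<Rightarrow> (real ^ 'd) set \<Rightarrow> bool"
  for r where
  empty: "pull_vertices r {} {}"
| cone: "least_lattice_point r P v \<Longrightarrow> F face_of P \<Longrightarrow> v \<notin> F \<Longrightarrow>
    pull_vertices r F (\<tau> - {v}) \<Longrightarrow> pull_vertices r P \<tau>"

section \<open>Least lattice points and faces of lattice polytopes\<close>

lemma least_lattice_point_unique:
  "antisym r \<Longrightarrow> least_lattice_point r P v \<Longrightarrow> least_lattice_point r P w \<Longrightarrow> v = w"
  unfolding least_lattice_point_def by (meson antisymD)

lemma least_lattice_point_face:
  "least_lattice_point r P v \<Longrightarrow> F face_of P \<Longrightarrow> v \<in> F \<Longrightarrow> least_lattice_point r F v"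
  unfolding least_lattice_point_def using face_of_imp_subset by blast

lemma lattice_polytope_face:
  "lattice_polytope P \<Longrightarrow> F face_of P \<Longrightarrow> lattice_polytope F"
  unfolding lattice_polytope_def
  by (auto simp: face_of_polytope_polytope extreme_point_of_face)

lemma finite_int_lattice_bounded:
  assumes "bounded (S :: (real ^ 'd) set)"
  shows "finite (S \<inter> int_lattice)"
proof -
  obtain B where B: "\<And>x. x \<in> S \<Longrightarrow> norm x \<le> B"
    using assms by (auto simp: bounded_iff)
  have fin: "finite {t :: real. t \<in> \<int> \<and> \<bar>t\<bar> \<le> B}"
    by (rule finite_abs_int_segment)
  have "S \<inter> int_lattice \<subseteq> vec_lambda ` (UNIV \<rightarrow>\<^sub>E {t :: real. t \<in> \<int> \<and> \<bar>t\<bar> \<le> B})"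
  proof
    fix x assume x: "x \<in> S \<inter> int_lattice"
    have "($) x \<in> UNIV \<rightarrow>\<^sub>E {t :: real. t \<in> \<int> \<and> \<bar>t\<bar> \<le> B}"
    proof (rule PiE_I)
      fix i
      show "x $ i \<in> {t :: real. t \<in> \<int> \<and> \<bar>t\<bar> \<le> B}"
        using x order_trans[OF component_le_norm_cart B] by (simp add: int_lattice_def)
    qed simp
    then show "x \<in> vec_lambda ` (UNIV \<rightarrow>\<^sub>E {t :: real. t \<in> \<int> \<and> \<bar>t\<bar> \<le> B})"
      by (rule rev_image_eqI) simp
  qed
  then show ?thesis
    by (rule finite_subset) (intro finite_imageI finite_PiE fin finite)
qed

text \<open>By Krein-Milman a nonempty polytope has an extreme point, here a lattice point;
  boundedness leaves only finitely many lattice points, and a linear order has a minimum on a finite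
  nonempty set.\<close>

lemma least_lattice_point_exists:
  assumes P: "lattice_polytope P" "P \<noteq> {}"
    and r: "linear_order_on A r" "P \<inter> int_lattice \<subseteq> A"
  obtains v where "least_lattice_point r P v"
proof -
  let ?L = "P \<inter> int_lattice"
  have "P = convex hull {x. x extreme_point_of P}"
    using P(1) Krein_Milman_Minkowski polytope_imp_compact polytope_imp_convex
    unfolding lattice_polytope_def by blast
  then have "{x. x extreme_point_of P} \<noteq> {}"
    using P(2) convex_hull_eq_empty by metis
  then obtain x where "x extreme_point_of P"
    by blast
  then have "x \<in> ?L"
    using P(1) unfolding lattice_polytope_def extreme_point_of_def by blast
  then have ne: "?L \<noteq> {}"
    by blast
  have fin: "finite ?L"
    using P(1) finite_int_lattice_bounded polytope_imp_bounded
    unfolding lattice_polytope_def by blast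
  have "\<exists>v\<in>M. \<forall>w\<in>M. (v, w) \<in> r" if "finite M" "M \<noteq> {}" "M \<subseteq> A" for M
    using that
  proof (induction M rule: finite_ne_induct)
    case (singleton x)
    then show ?case
      using r(1) by (auto simp: order_on_defs refl_on_def)
  next
    case (insert x M)
    then obtain v where v: "v \<in> M" "\<forall>w\<in>M. (v, w) \<in> r" by auto
    have tr: "trans r" and re: "(x, x) \<in> r" and "v = x \<or> (v, x) \<in> r \<or> (x, v) \<in> r"
      using r(1) insert.prems v(1) by (auto simp: order_on_defs refl_on_def total_on_def)
    then show ?case
      using v by (metis insert_iff transD)
  qed
  then show thesis
    using fin ne r(2) that unfolding least_lattice_point_def by blast
qed

text \<open>A face is cut out of its convex set by its own affine hull. This is what makes the apex
  of each cone affinely independent of the base.\<close>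

lemma face_of_not_in_affine_hull:
  fixes P :: "'a::euclidean_space set"
  assumes "convex P" "F face_of P" "v \<in> P" "v \<notin> F"
  shows "v \<notin> affine hull F"
  using face_of_imp_eq_affine_Int[OF assms(1,2)] assms(3,4) by blast

section \<open>Simplices of the pulling triangulation and their faces\<close>

lemma pull_vertices_lattice:
  "pull_vertices r P \<tau> \<Longrightarrow> finite \<tau> \<and> \<tau> \<subseteq> P \<inter> int_lattice"
proof (induction rule: pull_vertices.induct)
  case (cone P v F \<tau>)
  then show ?case
    using face_of_imp_subset[of F P] unfolding least_lattice_point_def by auto
qed simp

text \<open>Each apex lies in \<open>P\<close> but outside the base face \<open>F\<close>, hence
  outside \<open>affine hull F\<close>, so adding it to an independent set inside \<open>F\<close>
  keeps independence.\<close>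

lemma pull_vertices_independent:
  "pull_vertices r P \<tau> \<Longrightarrow> convex P \<Longrightarrow> \<not> affine_dependent \<tau>"
proof (induction rule: pull_vertices.induct)
  case (cone P v F \<tau>)
  have "\<tau> - {v} \<subseteq> F"
    using pull_vertices_lattice[OF cone(4)] by blast
  moreover have "v \<notin> affine hull F"
    using cone face_of_not_in_affine_hull unfolding least_lattice_point_def by blast
  ultimately have "v \<notin> affine hull (\<tau> - {v})"
    using hull_mono by blast
  moreover have "\<not> affine_dependent (\<tau> - {v})"
    using cone face_of_imp_convex by blast
  ultimately have "\<not> affine_dependent (insert v (\<tau> - {v}))"
    using affine_independent_insert by blast
  then show ?case
    by (metis affine_independent_subset insert_Diff_single subset_insertI)
qed simp

text \<open>The rule \<open>cone\<close> deletes \<open>v\<close> from \<tau> whether or not it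
  occurs there, so it yields simplices with and without the apex alike, and closure under subsets
  passes from the base to the cone.\<close>

lemma pull_vertices_subset:
  "pull_vertices r P \<tau> \<Longrightarrow> \<sigma> \<subseteq> \<tau> \<Longrightarrow> pull_vertices r P \<sigma>"
proof (induction arbitrary: \<sigma> rule: pull_vertices.induct)
  case (cone P v F \<tau>)
  then show ?case
    by (meson Diff_mono order_refl pull_vertices.cone)
qed (simp add: pull_vertices.empty)

text \<open>If the least lattice point \<open>v\<close> of \<open>P\<close> is outside
  \<open>F\<close>, then \<open>F\<close> itself serves as a base, with the apex left out. If
  \<open>v\<close> is in \<open>F\<close>, it is also the apex for \<open>F\<close>, and the base
  used there is a face of \<open>P\<close> by transitivity.\<close>

lemma pull_vertices_of_face:
  assumes r: "linear_order_on A r" "P \<inter> int_lattice \<subseteq> A" and P: "lattice_polytope P"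
    and F: "F face_of P" "pull_vertices r F \<tau>"
  shows "pull_vertices r P \<tau>"
proof (cases "P = {}")
  case True
  then show ?thesis using F by simp
next
  case False
  have anti: "antisym r"
    using r(1) by (simp add: order_on_defs)
  obtain v where v: "least_lattice_point r P v"
    using least_lattice_point_exists[OF P False r] .
  show ?thesis
  proof (cases "v \<in> F")
    case False
    then have "\<tau> - {v} = \<tau>"
      using pull_vertices_lattice[OF F(2)] by blast
    then show ?thesis
      using pull_vertices.cone[OF v F(1) False] F(2) by simp
  next
    case True
    from F(2) show ?thesis
    proof cases
      case empty
      then show ?thesis using True by simp
    next
      case (cone w G)
      have "w = v"
        using least_lattice_point_unique[OF anti cone(1) least_lattice_point_face[OF v F(1) True]] .
      then show ?thesis
        using cone F(1) v pull_vertices.cone face_of_trans by blast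
    qed
  qed
qed

text \<open>Converse to \<open>pull_vertices_of_face\<close>. The base \<open>G\<close> is replaced
  by \<open>F \<inter> G\<close>, a face of both \<open>F\<close> and \<open>G\<close>. If
  \<open>v\<close> lies in \<open>F\<close>, the cone over it is formed inside \<open>F\<close>;
  otherwise \<tau> lies in \<open>F \<inter> G\<close> and is lifted to \<open>F\<close>.\<close>

lemma pull_vertices_restrict:
  assumes "linear_order_on A r"
  shows "pull_vertices r P \<tau> \<Longrightarrow> P \<inter> int_lattice \<subseteq> A \<Longrightarrow> lattice_polytope P \<Longrightarrow>
    F face_of P \<Longrightarrow> \<tau> \<subseteq> F \<Longrightarrow> pull_vertices r F \<tau>"
proof (induction arbitrary: F rule: pull_vertices.induct)
  case empty
  then show ?case
    by (simp add: pull_vertices.empty)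
next
  case (cone P v G \<tau>)
  have sub: "F \<subseteq> P" "G \<subseteq> P"
    using cone.hyps(2) cone.prems(3) face_of_imp_subset by blast+
  have FG: "F \<inter> G face_of P"
    using face_of_Int cone.hyps(2) cone.prems(3) by blast
  have FG1: "F \<inter> G face_of F" "F \<inter> G face_of G"
    using FG sub face_of_subset by blast+
  have "\<tau> - {v} \<subseteq> F \<inter> G"
    using pull_vertices_lattice[OF cone.hyps(4)] cone.prems(4) by blast
  then have FG2: "pull_vertices r (F \<inter> G) (\<tau> - {v})"
    using cone.IH[of "F \<inter> G"] cone.prems(1,2) cone.hyps(2) FG1(2) sub(2) lattice_polytope_face
    by blast
  show ?case
  proof (cases "v \<in> F")
    case True
    then show ?thesis
      using pull_vertices.cone[OF least_lattice_point_face[OF cone.hyps(1) cone.prems(3)] FG1(1) _ FG2]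
        cone.hyps(3) by blast
  next
    case False
    then have "\<tau> - {v} = \<tau>"
      using cone.prems(4) by blast
    then have "pull_vertices r (F \<inter> G) \<tau>"
      using FG2 by simp
    then show ?thesis
      using pull_vertices_of_face[OF assms _ _ FG1(1)] cone.prems lattice_polytope_face sub(1) by blast
  qed
qed

section \<open>Barycentric coordinates\<close>

text \<open>For affinely independent \<tau> this says that \<open>x\<close> is in the relative
  interior of the simplex on \<tau>, with barycentric coordinates \<open>u\<close>. Total weight 1
  forces \<tau> to be finite, since sums over infinite sets are 0.\<close>

definition positive_combination :: "'a::real_vector set \<Rightarrow> ('a \<Rightarrow> real) \<Rightarrow> 'a \<Rightarrow> bool" where
  "positive_combination \<tau> u x \<longleftrightarrow>
     (\<forall>w\<in>\<tau>. 0 < u w) \<and> sum u \<tau> = 1 \<and> (\<Sum>w\<in>\<tau>. u w *\<^sub>R w) = x"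

lemma positive_combination_mem:
  assumes "positive_combination \<tau> u x" "convex P" "\<tau> \<subseteq> P"
  shows "x \<in> P"
proof -
  have "finite \<tau>"
    using assms(1) sum.infinite unfolding positive_combination_def by fastforce
  then show ?thesis
    using assms convex_sum[of \<tau> P u "\<lambda>w. w"] unfolding positive_combination_def
    by (metis less_imp_le subset_iff)
qed

text \<open>Strict positivity puts \<open>x\<close> in the relative interior of the simplex, and a
  face that meets the relative interior of a convex subset contains all of it.\<close>

lemma positive_combination_subset_face:
  fixes \<tau> :: "'a::euclidean_space set"
  assumes "positive_combination \<tau> u x" "\<not> affine_dependent \<tau>" "\<tau> \<subseteq> P" "F face_of P" "x \<in> F" "convex P"
  shows "\<tau> \<subseteq> F"
proof -
  have "x \<in> rel_interior (convex hull \<tau>)"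
    unfolding rel_interior_convex_hull_explicit[OF assms(2)]
    using assms(1) by (auto simp: positive_combination_def)
  then have "F \<inter> rel_interior (convex hull \<tau>) \<noteq> {}"
    using assms(5) by blast
  moreover have "convex hull \<tau> \<subseteq> P"
    using assms(3,6) by (simp add: hull_minimal)
  ultimately have "convex hull \<tau> \<subseteq> F"
    using subset_of_face_of assms(4) by blast
  then show ?thesis
    using hull_subset[of \<tau> convex] by blast
qed

lemma positive_combination_cone:
  assumes "positive_combination \<tau> u y" "0 < s" "s < 1" "v \<notin> \<tau>" "finite \<tau>"
  shows "positive_combination (insert v \<tau>) (\<lambda>w. if w = v then 1 - s else s * u w)
    ((1 - s) *\<^sub>R v + s *\<^sub>R y)"
proof -
  have 1: "(\<Sum>w\<in>\<tau>. if w = v then 1 - s else s * u w) = s * sum u \<tau>"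
    using assms(4) by (auto simp: sum_distrib_left intro!: sum.cong)
  have 2: "(\<Sum>w\<in>\<tau>. (if w = v then 1 - s else s * u w) *\<^sub>R w) = s *\<^sub>R (\<Sum>w\<in>\<tau>. u w *\<^sub>R w)"
    using assms(4) by (auto simp: scaleR_sum_right intro!: sum.cong)
  show ?thesis
    using assms unfolding positive_combination_def
    by (simp add: 1 2)
qed

text \<open>Projection away from the vertex \<open>v\<close>: the other weights sum to
  \<open>1 - u v\<close>, which is positive because a second vertex exists, and are rescaled by
  it.\<close>

lemma positive_combination_uncone:
  assumes "positive_combination \<tau> u x" "v \<in> \<tau>" "\<tau> \<noteq> {v}"
  obtains y where "u v < 1" "positive_combination (\<tau> - {v}) (\<lambda>w. u w / (1 - u v)) y"
    "x = u v *\<^sub>R v + (1 - u v) *\<^sub>R y"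
proof -
  have fin: "finite \<tau>"
    using assms(1) sum.infinite unfolding positive_combination_def by fastforce
  have s: "sum u (\<tau> - {v}) = 1 - u v"
    using assms(1,2) fin unfolding positive_combination_def
    by (simp add: sum_diff1)
  have pos: "sum u (\<tau> - {v}) > 0"
    by (rule sum_pos) (use assms fin in \<open>auto simp: positive_combination_def\<close>)
  define y where "y = (\<Sum>w\<in>\<tau> - {v}. (u w / (1 - u v)) *\<^sub>R w)"
  have lt: "u v < 1"
    using s pos by simp
  have "(1 - u v) *\<^sub>R y = (\<Sum>w\<in>\<tau> - {v}. u w *\<^sub>R w)"
    using lt unfolding y_def by (simp add: scaleR_sum_right)
  then have "x = u v *\<^sub>R v + (1 - u v) *\<^sub>R y"
    using assms(1,2) fin unfolding positive_combination_def
    by (simp add: sum_diff1)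
  moreover have "positive_combination (\<tau> - {v}) (\<lambda>w. u w / (1 - u v)) y"
    using assms(1) s lt y_def unfolding positive_combination_def
    by (simp flip: sum_divide_distrib)
  ultimately show thesis
    using that lt by blast
qed

section \<open>Every point has a carrier simplex\<close>

lemma pull_vertices_cover:
  assumes r: "linear_order_on A r"
  shows "lattice_polytope P \<Longrightarrow> P \<inter> int_lattice \<subseteq> A \<Longrightarrow> x \<in> P \<Longrightarrow>
    \<exists>\<tau> u. pull_vertices r P \<tau> \<and> positive_combination \<tau> u x"
\<comment> \<open>The empty set has \<open>aff_dim\<close> -1, so adding 1 keeps the measure free of
  truncation; proper faces have smaller dimension.\<close>
proof (induction "nat (aff_dim P + 1)" arbitrary: P x rule: less_induct)
  case less
  have poly: "polytope P" and conv: "convex P"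
    using less.prems(1) polytope_imp_convex unfolding lattice_polytope_def by blast+
  have IH: "\<exists>\<tau> u. pull_vertices r F \<tau> \<and> positive_combination \<tau> u y"
    if F: "F face_of P" "F \<noteq> P" and y: "y \<in> F" for F y
  proof (rule less.hyps)
    have "aff_dim F < aff_dim P"
      using face_of_aff_dim_lt[OF conv F] .
    then show "nat (aff_dim F + 1) < nat (aff_dim P + 1)"
      using aff_dim_geq[of F] by linarith
    show "lattice_polytope F" "F \<inter> int_lattice \<subseteq> A"
      using less.prems F lattice_polytope_face face_of_imp_subset by blast+
  qed (fact y)
  have rf: "\<exists>F. F face_of P \<and> F \<noteq> P \<and> y \<in> F" if "y \<in> rel_frontier P" for y
    using that rel_frontier_of_polyhedron_alt[OF polytope_imp_polyhedron[OF poly]] by blast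
  obtain v where v: "least_lattice_point r P v"
    using least_lattice_point_exists[OF less.prems(1) _ r less.prems(2)] less.prems(3) by blast
  then have vP: "v \<in> P"
    unfolding least_lattice_point_def by blast
  show ?case
  proof (cases "x \<in> rel_interior P")
    case False
    then have "x \<in> rel_frontier P"
      using less.prems(3) closure_subset unfolding rel_frontier_def by blast
    then show ?thesis
      using rf IH pull_vertices_of_face[OF r less.prems(2,1)] by blast
  next
    case inner: True
    show ?thesis
    proof (cases "x = v")
      case True
      have "pull_vertices r P {v}"
        by (rule pull_vertices.cone[OF v, of "{}"]) (auto simp: pull_vertices.empty)
      moreover have "positive_combination {v} (\<lambda>_. 1) x"
        using True by (simp add: positive_combination_def)
      ultimately show ?thesis by blast
    next
      case False
      have "x + (x - v) \<in> affine hull P"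
        using mem_affine_3_minus[OF affine_affine_hull, of x P x v 1] less.prems(3) vP
        by (simp add: hull_inc)
      then obtain d where d: "0 < d" "x + d *\<^sub>R (x - v) \<in> rel_frontier P"
        using ray_to_rel_frontier[OF polytope_imp_bounded[OF poly] inner, of "x - v"] False by auto
      define y where "y = x + d *\<^sub>R (x - v)"
      \<comment> \<open>Solving \<open>y = x + d *\<^sub>R (x - v)\<close> for \<open>x\<close>
        gives weight \<open>d / (1 + d)\<close> on \<open>v\<close> and \<open>1 / (1 + d)\<close>
        on \<open>y\<close>.\<close>
      define s where "s = 1 / (1 + d)"
      have s: "0 < s" "s < 1"
        using d(1) by (auto simp: s_def)
      have "(1 + d) *\<^sub>R x = d *\<^sub>R v + y"
        by (simp add: y_def algebra_simps)
      moreover have "x = s *\<^sub>R ((1 + d) *\<^sub>R x)"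
        using d(1) by (simp add: s_def)
      ultimately have "x = s *\<^sub>R (d *\<^sub>R v + y)"
        by simp
      moreover have "s * d = 1 - s"
        using d(1) by (simp add: s_def field_simps)
      ultimately have x: "x = (1 - s) *\<^sub>R v + s *\<^sub>R y"
        by (simp add: scaleR_right_distrib)
      obtain F where F: "F face_of P" "F \<noteq> P" "y \<in> F"
        using rf d(2) y_def by blast
      \<comment> \<open>Otherwise the whole segment from \<open>v\<close> to \<open>y\<close>, with
        the relatively interior point \<open>x\<close> on it, would lie in a proper face.\<close>
      have "v \<notin> F"
      proof
        assume "v \<in> F"
        then have "x \<in> F"
          unfolding x using face_of_imp_convex[OF F(1)] F(3) s by (simp add: convexD)
        then show False
          using inner face_of_disjoint_rel_interior[OF F(1,2)] by blast
      qed
      obtain \<tau> u where \<tau>: "pull_vertices r F \<tau>" "positive_combination \<tau> u y"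
        using IH[OF F] by blast
      have fin: "finite \<tau>" "v \<notin> \<tau>"
        using pull_vertices_lattice[OF \<tau>(1)] \<open>v \<notin> F\<close> by blast+
      have "pull_vertices r P (insert v \<tau>)"
        using pull_vertices.cone[OF v F(1) \<open>v \<notin> F\<close>] \<tau>(1) fin(2) by simp
      then show ?thesis
        using positive_combination_cone[OF \<tau>(2) s fin(2,1)] x by blast
    qed
  qed
qed

section \<open>Uniqueness of the carrier simplex\<close>

text \<open>A ray from \<open>v\<close> meets the faces that avoid \<open>v\<close> in at most one point.\<close>

lemma face_ray_contradiction:
  fixes v :: "'a::euclidean_space"
  assumes "F face_of P" "v \<in> P" "v \<notin> F" "y \<in> F" "y' \<in> P"
    and eq: "a *\<^sub>R v + (1 - a) *\<^sub>R y = b *\<^sub>R v + (1 - b) *\<^sub>R y'" and "a < b" "b < 1"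
  shows False
proof -
  \<comment> \<open>As \<open>a < b\<close>, the point \<open>y\<close> lies strictly between
    \<open>v\<close> and \<open>y'\<close>, at parameter \<open>c\<close>; a face containing
    \<open>y\<close> then has to contain \<open>v\<close>.\<close>
  define c where "c = (1 - b) / (1 - a)"
  have c: "0 < c" "c < 1" "(1 - a) * c = 1 - b"
    using assms(7,8) by (auto simp: c_def)
  have "(1 - a) *\<^sub>R y = (1 - a) *\<^sub>R v + (1 - b) *\<^sub>R (y' - v)"
    using eq by (simp add: algebra_simps)
  also have "\<dots> = (1 - a) *\<^sub>R (v + c *\<^sub>R (y' - v))"
    by (simp add: c(3) scaleR_add_right)
  finally have "y = v + c *\<^sub>R (y' - v)"
    using assms(7,8) by simp
  then have y: "y = (1 - c) *\<^sub>R v + c *\<^sub>R y'"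
    by (simp add: algebra_simps)
  have "v \<noteq> y'"
  proof
    assume "v = y'"
    then have "y = v" by (simp add: y algebra_simps)
    then show False using assms by simp
  qed
  then have "y \<in> open_segment v y'"
    using y c unfolding in_segment by blast
  then show False
    using assms unfolding face_of_def by blast
qed

text \<open>The case split applied to both simplices in \<open>pull_vertices_unique\<close>: either
  \<open>x\<close> is the apex, or it lies over a base point \<open>y\<close> with apex weight
  \<open>a\<close>, where \<open>a = 0\<close> encodes that the apex is not a vertex of
  \<tau>.\<close>

lemma positive_combination_apex:
  fixes \<tau> :: "(real ^ 'd) set"
  assumes "positive_combination \<tau> u x" "\<tau> - {v} \<subseteq> F" "convex F" "v \<notin> F"
  obtains (apex) "\<tau> = {v}" "x = v"
  | (cone) a y where "0 \<le> a" "a < 1" "v \<in> \<tau> \<longleftrightarrow> 0 < a" "y \<in> F"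
      "positive_combination (\<tau> - {v}) (\<lambda>w. u w / (1 - a)) y" "x = a *\<^sub>R v + (1 - a) *\<^sub>R y"
proof (cases "v \<in> \<tau>")
  case False
  then have "\<tau> - {v} = \<tau>" by simp
  then show thesis
    using cone[of 0 x] positive_combination_mem[OF assms(1,3)] assms(1,2) False by simp
next
  case True
  show thesis
  proof (cases "\<tau> = {v}")
    case t: True
    then have "u v = 1" "x = u v *\<^sub>R v"
      using assms(1) by (auto simp: positive_combination_def)
    then show thesis
      using apex t by simp
  next
    case False
    obtain y where y: "u v < 1" "positive_combination (\<tau> - {v}) (\<lambda>w. u w / (1 - u v)) y"
      "x = u v *\<^sub>R v + (1 - u v) *\<^sub>R y"
      using positive_combination_uncone[OF assms(1) True False] .
    have "0 < u v"
      using assms(1) True by (simp add: positive_combination_def)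
    then show thesis
      using cone[of "u v" y] y True positive_combination_mem[OF y(2) assms(3,2)] by simp
  qed
qed

text \<open>Both simplices are cones from the same \<open>v\<close> over faces that avoid
  \<open>v\<close>. The ray from \<open>v\<close> through \<open>x\<close> determines the base point
  and the weight of \<open>v\<close>, and the induction hypothesis compares the bases.\<close>

lemma pull_vertices_unique:
  assumes r: "linear_order_on A r"
  shows "pull_vertices r P \<tau> \<Longrightarrow> lattice_polytope P \<Longrightarrow> P \<inter> int_lattice \<subseteq> A \<Longrightarrow>
    pull_vertices r P \<sigma> \<Longrightarrow> positive_combination \<tau> u x \<Longrightarrow> positive_combination \<sigma> u' x \<Longrightarrow> \<tau> = \<sigma>"
proof (induction arbitrary: \<sigma> u u' x rule: pull_vertices.induct)
  case empty
  then show ?case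
    by (simp add: positive_combination_def)
next
  case (cone P v F \<tau>)
  have conv: "convex P"
    using cone.prems(1) polytope_imp_convex unfolding lattice_polytope_def by blast
  have vP: "v \<in> P"
    using cone.hyps(1) unfolding least_lattice_point_def by blast
  have anti: "antisym r"
    using r by (simp add: order_on_defs)
  \<comment> \<open>\<open>P\<close> contains \<open>v\<close>, so the rule \<open>empty\<close>
    cannot have produced \<sigma>, and antisymmetry makes its apex equal to
    \<open>v\<close>.\<close>
  obtain F' where F': "F' face_of P" "v \<notin> F'" "pull_vertices r F' (\<sigma> - {v})"
    using cone.prems(3)
  proof cases
    case empty
    then show ?thesis using vP by simp
  next
    case (cone w G)
    then have "w = v"
      using least_lattice_point_unique[OF anti] \<open>least_lattice_point r P v\<close> by blast
    then show ?thesis using cone that by blast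
  qed
  note F = cone.hyps(2-4)
  have convF: "convex F" "convex F'"
    using F(1) F'(1) face_of_imp_convex by blast+
  have subP: "F \<subseteq> P" "F' \<subseteq> P"
    using F(1) F'(1) face_of_imp_subset by blast+
  have sub: "\<tau> - {v} \<subseteq> F" "\<sigma> - {v} \<subseteq> F'"
    using pull_vertices_lattice F(3) F'(3) by blast+
  have not_apex: "False" if "v = a *\<^sub>R v + (1 - a) *\<^sub>R y" "a < 1" "y \<in> G" "v \<notin> G" for a y G
  proof -
    have "(1 - a) *\<^sub>R v = (1 - a) *\<^sub>R y"
      using that(1) by (simp add: algebra_simps)
    then show False using that by simp
  qed
  from cone.prems(4) sub(1) convF(1) F(2) show ?case
  proof (cases rule: positive_combination_apex)
    case apex
    from cone.prems(5) sub(2) convF(2) F'(2) show ?thesis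
    proof (cases rule: positive_combination_apex)
      case (cone b z)
      then have "v = b *\<^sub>R v + (1 - b) *\<^sub>R z"
        using apex(2) by metis
      then show ?thesis using not_apex[OF _ cone(2,4) F'(2)] by blast
    qed (use apex in simp)
  next
    case c: (cone a y)
    from cone.prems(5) sub(2) convF(2) F'(2) show ?thesis
    proof (cases rule: positive_combination_apex)
      case apex
      then have "v = a *\<^sub>R v + (1 - a) *\<^sub>R y"
        using c(6) by metis
      then show ?thesis using not_apex[OF _ c(2,4) F(2)] by blast
    next
      case d: (cone b z)
      have P: "y \<in> P" "z \<in> P"
        using c(4) d(4) subP by blast+
      have "a = b"
        using face_ray_contradiction[OF F(1) vP F(2) c(4) P(2)]
          face_ray_contradiction[OF F'(1) vP F'(2) d(4) P(1)] c(2,6) d(2,6)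
        by (metis linorder_neqE_linordered_idom)
      then have yz: "y = z"
        using c(2,6) d(6) by simp
      have iff: "v \<in> \<tau> \<longleftrightarrow> v \<in> \<sigma>"
        using c(3) d(3) \<open>a = b\<close> by blast
      \<comment> \<open>The base faces \<open>F\<close> and \<open>F'\<close> may differ, while the
        induction hypothesis concerns \<open>F\<close> only. The common base point lies in
        \<open>F\<close> and drags all of \<open>\<sigma> - {v}\<close> into
        \<open>F\<close>.\<close>
      have "\<sigma> - {v} \<subseteq> F"
      proof (rule positive_combination_subset_face[OF d(5) _ _ F(1) _ conv])
        show "\<not> affine_dependent (\<sigma> - {v})"
          using pull_vertices_independent[OF F'(3) convF(2)] .
        show "\<sigma> - {v} \<subseteq> P"
          using sub(2) subP(2) by (rule subset_trans)
        show "z \<in> F"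
          using c(4) yz by simp
      qed
      moreover have "pull_vertices r P (\<sigma> - {v})"
        using pull_vertices_subset[OF cone.prems(3)] by blast
      ultimately have "pull_vertices r F (\<sigma> - {v})"
        using pull_vertices_restrict[OF r _ cone.prems(2,1) F(1)] by blast
      moreover have "lattice_polytope F" "F \<inter> int_lattice \<subseteq> A"
        using lattice_polytope_face[OF cone.prems(1) F(1)] subP(1) cone.prems(2) by blast+
      ultimately have "\<tau> - {v} = \<sigma> - {v}"
        using cone.IH c(5) d(5) yz by blast
      then show ?thesis
        using iff by blast
    qed
  qed
qed

lemma positive_combination_coefficients_unique:
  assumes "positive_combination \<tau> u x" "positive_combination \<tau> u' x" "\<not> affine_dependent \<tau>" "w \<in> \<tau>"
  shows "u w = u' w"
proof (rule ccontr)
  assume ne: "u w \<noteq> u' w"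
  have fin: "finite \<tau>"
    using assms(1) sum.infinite unfolding positive_combination_def by fastforce
  have "sum (\<lambda>w. u w - u' w) \<tau> = 0" "(\<Sum>w\<in>\<tau>. (u w - u' w) *\<^sub>R w) = 0"
    using assms(1,2) unfolding positive_combination_def
    by (simp_all add: sum_subtractf scaleR_left_diff_distrib)
  then have "affine_dependent \<tau>"
    unfolding affine_dependent_explicit_finite[OF fin] using ne assms(4)
    by (intro exI[of _ "\<lambda>w. u w - u' w"]) auto
  then show False
    using assms(3) by blast
qed

section \<open>Comparison with the recursively defined pulling triangulation\<close>

text \<open>\<open>compressed\<close> quantifies over orders on the lattice points of one polytope,
  so an order shared by many polytopes has to be cut down before it applies.\<close>

lemma in_pull_subset_order:
  "in_pull r P S \<Longrightarrow> P \<inter> int_lattice \<subseteq> A \<Longrightarrow> in_pull (r \<inter> A \<times> A) P S"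
proof (induction rule: in_pull.induct)
  case (simplex P S)
  then show ?case by (simp add: in_pull.simplex)
next
  case (pull P v F G S)
  have "F \<inter> int_lattice \<subseteq> A"
    using face_of_imp_subset[OF pull.hyps(4)] pull.prems by blast
  moreover have "\<forall>w \<in> P \<inter> int_lattice. (v, w) \<in> r \<inter> A \<times> A"
    using pull.hyps(2,3) pull.prems by blast
  ultimately show ?case
    using in_pull.pull[OF pull.hyps(1,2) _ pull.hyps(4,5) _ pull.hyps(7)] pull.IH by blast
qed

text \<open>Carries the unimodularity given by \<open>compressed\<close> over to vertex sets. In an
  empty simplex all lattice points are vertices, so \<tau> spans a face. Otherwise \<tau>, with or
  without \<open>v\<close>, spans a face of the simplex on \<open>insert v \<tau>\<close>, which is
  the cone over the base.\<close>

lemma pull_vertices_in_pull: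
  fixes P :: "(real ^ 'd) set"
  shows "pull_vertices r P \<tau> \<Longrightarrow> lattice_polytope P \<Longrightarrow> in_pull r P (convex hull \<tau>)"
proof (induction rule: pull_vertices.induct)
  case empty
  have "empty_simplex ({} :: (real ^ 'd) set)"
    unfolding empty_simplex_def by (auto simp: extreme_point_of_def)
  then show ?case
    using in_pull.simplex[of "{}" "{}"] by (simp add: face_of_refl)
next
  case (cone P v F \<tau>)
  have conv: "convex P"
    using cone.prems polytope_imp_convex unfolding lattice_polytope_def by blast
  have \<tau>: "pull_vertices r P \<tau>"
    using cone.hyps by (rule pull_vertices.cone)
  show ?case
  proof (cases "empty_simplex P")
    case True
    then obtain B where B: "\<not> affine_dependent B" "P = convex hull B"
      unfolding empty_simplex_def simplex_def by blast
    have "\<tau> \<subseteq> B"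
      using pull_vertices_lattice[OF \<tau>] True extreme_point_of_convex_hull_affine_independent[OF B(1)]
      unfolding empty_simplex_def B(2) by blast
    then have "convex hull \<tau> face_of P"
      unfolding B(2) face_of_convex_hull_affine_independent[OF B(1)] by blast
    then show ?thesis
      using in_pull.simplex[OF True] by blast
  next
    case False
    have ind: "\<not> affine_dependent (insert v \<tau>)"
    proof -
      have "pull_vertices r P (insert v \<tau>)"
        using pull_vertices.cone[OF cone.hyps(1-3), of "insert v \<tau>"] cone.hyps(4) by simp
      then show ?thesis
        using pull_vertices_independent conv by blast
    qed
    have "convex hull (insert v (convex hull (\<tau> - {v}))) = convex hull (insert v \<tau>)"
      by (metis hull_insert insert_Diff_single)
    then have "convex hull \<tau> face_of convex hull (insert v (convex hull (\<tau> - {v})))"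
      using face_of_convex_hull_affine_independent[OF ind] by auto
    moreover have "in_pull r F (convex hull (\<tau> - {v}))"
      using cone.IH lattice_polytope_face[OF cone.prems cone.hyps(2)] by blast
    ultimately show ?thesis
      using in_pull.pull[OF False _ _ cone.hyps(2,3)] cone.hyps(1)
      unfolding least_lattice_point_def by blast
  qed
qed

section \<open>Lattice points of dilated compressed complexes\<close>

text \<open>The isomorphism sends the vertices to distinct unit vectors, so the barycentric
  coordinates of a point become ordinary coordinates of its image, and these are integers for a
  lattice point.\<close>

lemma unimodular_simplex_integral_coordinates:
  fixes \<tau> :: "(real ^ 'd) set"
  assumes uni: "unimodular_simplex (convex hull \<tau>)" and ind: "\<not> affine_dependent \<tau>"
    and lat: "\<tau> \<subseteq> int_lattice" "(\<Sum>w\<in>\<tau>. u w *\<^sub>R w) \<in> int_lattice"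
    and sum: "sum u \<tau> \<in> \<int>" and w: "w \<in> \<tau>"
  shows "u w \<in> \<int>"
proof -
  obtain n and J :: "'d option set" and f g c where n: "n simplex (convex hull \<tau>)" "int (card J) = n + 1"
    and g: "linear g" "f = (\<lambda>x. g x + c)"
    and bij: "bij_betw f (affine hull \<tau>) (affine hull (convex hull ((\<lambda>j. axis j 1 :: real ^ ('d option)) ` J)))"
    and bijZ: "bij_betw f (affine hull \<tau> \<inter> int_lattice)
      (affine hull (convex hull ((\<lambda>j. axis j 1 :: real ^ ('d option)) ` J)) \<inter> int_lattice)"
    and im: "f ` (convex hull \<tau>) = convex hull ((\<lambda>j. axis j 1 :: real ^ ('d option)) ` J)"
    using uni unfolding unimodular_simplex_def lattice_isomorphic_def affine_hull_convex_hull[of \<tau>]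
    by (elim exE conjE) (rule that)
  let ?E = "(\<lambda>j. axis j 1 :: real ^ ('d option)) ` J"
  have fin: "finite \<tau>"
    using ind aff_independent_finite by blast
  obtain B where B: "\<not> affine_dependent B" "int (card B) = n + 1" "convex hull \<tau> = convex hull B"
    using n(1) unfolding simplex_def by blast
  have "B = \<tau>"
    using extreme_point_of_convex_hull_affine_independent[OF B(1)]
      extreme_point_of_convex_hull_affine_independent[OF ind] B(3) by auto
  then have cards: "card \<tau> = card J"
    using B(2) n(2) by simp
  have indE: "\<not> affine_dependent ?E"
  proof -
    have "?E \<subseteq> Basis"
      by (auto simp: axis_in_Basis_iff)
    then show ?thesis
      using independent_mono[OF independent_Basis] affine_dependent_imp_dependent by blast
  qed
  have hull: "convex hull ?E = convex hull (f ` \<tau>)"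
  proof -
    have f: "f ` X = (+) c ` g ` X" for X
      unfolding g(2) by (auto simp: image_image add.commute)
    show ?thesis
      unfolding im[symmetric] f convex_hull_translation convex_hull_linear_image[OF g(1)] ..
  qed
  \<comment> \<open>Unit vectors are extreme points of the hull of \<open>f\<close>
    \<tau>\<open>, hence belong to\<close>f \<open>\<tau>\<close>; equality follows by
    counting.\<close>
  have "?E \<subseteq> f ` \<tau>"
  proof
    fix e assume "e \<in> ?E"
    then have "e extreme_point_of (convex hull ?E)"
      using extreme_point_of_convex_hull_affine_independent[OF indE] by blast
    then show "e \<in> f ` \<tau>"
      unfolding hull by (rule extreme_point_of_convex_hull)
  qed
  moreover have "card ?E = card J"
    by (rule card_image) (auto simp: inj_on_def axis_eq_axis)
  ultimately have fE: "f ` \<tau> = ?E"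
    using card_seteq[of "f ` \<tau>" ?E] fin card_image_le[OF fin, of f] cards by simp
  have injf: "inj_on f \<tau>"
    using bij hull_subset[of \<tau> affine] unfolding bij_betw_def by (blast intro: inj_on_subset)
  \<comment> \<open>Subtracting a multiple of the vertex \<open>w\<close> moves the lattice point into the affine hull, where the
    isomorphism with the standard simplex applies.\<close>
  define a where "a v = u v - (if v = w then sum u \<tau> - 1 else 0)" for v
  have asum: "sum a \<tau> = 1"
    using fin w by (simp add: a_def sum_subtractf)
  define z where "z = (\<Sum>v\<in>\<tau>. a v *\<^sub>R v)"
  have "z = (\<Sum>v\<in>\<tau>. u v *\<^sub>R v) - (\<Sum>v\<in>\<tau>. (if v = w then sum u \<tau> - 1 else 0) *\<^sub>R v)"
    unfolding z_def a_def by (simp add: scaleR_left_diff_distrib sum_subtractf)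
  also have "(\<Sum>v\<in>\<tau>. (if v = w then sum u \<tau> - 1 else 0) *\<^sub>R v) = (\<Sum>v\<in>\<tau>. if v = w then (sum u \<tau> - 1) *\<^sub>R v else 0)"
    by (rule sum.cong) auto
  also have "\<dots> = (sum u \<tau> - 1) *\<^sub>R w"
    using fin w by simp
  finally have "z \<in> int_lattice"
    using lat w sum by (auto simp: int_lattice_def)
  moreover have "z \<in> affine hull \<tau>"
    unfolding affine_hull_finite[OF fin] z_def using asum by blast
  ultimately have fz: "f z \<in> int_lattice"
    using bijZ unfolding bij_betw_def by blast
  have "f z = (\<Sum>v\<in>\<tau>. a v *\<^sub>R g v) + sum a \<tau> *\<^sub>R c"
    unfolding g(2) z_def asum by (simp add: linear_sum[OF g(1)] linear_scale[OF g(1)])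
  also have "\<dots> = (\<Sum>v\<in>\<tau>. a v *\<^sub>R f v)"
    unfolding g(2) by (simp add: scaleR_add_right sum.distrib scaleR_sum_left)
  finally have fz_eq: "f z = (\<Sum>v\<in>\<tau>. a v *\<^sub>R f v)" .
  obtain j where j: "f w = axis j 1"
    using fE w by blast
  have "f v $ j = (if v = w then 1 else 0)" if v: "v \<in> \<tau>" for v
  proof (cases "v = w")
    case False
    obtain j' where j': "f v = axis j' 1"
      using fE v by blast
    have "f v \<noteq> f w"
      using injf v w False by (meson inj_onD)
    then show ?thesis
      using j j' False by (auto simp: axis_def)
  qed (simp add: j axis_def)
  then have "f z $ j = (\<Sum>v\<in>\<tau>. if v = w then a v else 0)"
    unfolding fz_eq by (auto simp: intro!: sum.cong)
  then have "f z $ j = a w"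
    using fin w by simp
  then have "a w \<in> \<int>"
    using fz unfolding int_lattice_def by (metis mem_Collect_eq)
  moreover have "u w = a w + (sum u \<tau> - 1)"
    by (simp add: a_def)
  ultimately show ?thesis
    using sum by simp
qed

lemma linear_order_on_subset_Restr:
  assumes "linear_order_on A r" "B \<subseteq> A"
  shows "linear_order_on B (r \<inter> B \<times> B)"
proof -
  have r: "refl_on A r" "trans r" "antisym r" "total_on A r"
    using assms(1) by (simp_all add: order_on_defs)
  have "refl_on B (r \<inter> B \<times> B)"
    using r(1) assms(2) by (auto simp: refl_on_def)
  moreover have "trans (r \<inter> B \<times> B)"
    using r(2) by (auto intro!: transI dest: transD)
  moreover have "antisym (r \<inter> B \<times> B)"
    using r(3) by (auto intro!: antisymI dest: antisymD)
  moreover have "total_on B (r \<inter> B \<times> B)"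
    using r(4) assms(2) by (auto simp: total_on_def)
  ultimately show ?thesis
    by (simp add: order_on_defs)
qed

lemma compressed_pull_vertices_unimodular:
  assumes "compressed P" "linear_order_on A r" "P \<inter> int_lattice \<subseteq> A" "pull_vertices r P \<tau>"
  shows "unimodular_simplex (convex hull \<tau>)"
proof -
  let ?L = "P \<inter> int_lattice"
  have "in_pull (r \<inter> ?L \<times> ?L) P (convex hull \<tau>)"
    using in_pull_subset_order[OF pull_vertices_in_pull[OF assms(4)]] assms(1)
    unfolding compressed_def by blast
  then show ?thesis
    using assms(1) linear_order_on_subset_Restr[OF assms(2,3)]
    unfolding compressed_def pulling_triangulation_def by blast
qed

section \<open>Gluing the triangulations of the members of a complex\<close>

definition pull_complex ::
    "((real ^ 'd) \<times> (real ^ 'd)) set \<Rightarrow> (real ^ 'd) set set \<Rightarrow> (real ^ 'd) set set" where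
  "pull_complex r C = {\<tau>. \<exists>P\<in>C. pull_vertices r P \<tau>}"

text \<open>A simplex of \<open>P\<close> whose relative interior meets \<open>Q\<close> lies in the
  common face \<open>P \<inter> Q\<close>; it restricts to that face and from there extends to
  \<open>Q\<close>.\<close>

lemma pull_vertices_transfer:
  assumes r: "linear_order_on A r" "P \<inter> int_lattice \<subseteq> A" "Q \<inter> int_lattice \<subseteq> A"
    and lat: "lattice_polytope P" "lattice_polytope Q"
    and face: "P \<inter> Q face_of P" "P \<inter> Q face_of Q"
    and \<tau>: "pull_vertices r P \<tau>" "positive_combination \<tau> u x" "x \<in> Q"
  shows "pull_vertices r Q \<tau>"
proof -
  have conv: "convex P"
    using lat(1) polytope_imp_convex unfolding lattice_polytope_def by blast
  have sub: "\<tau> \<subseteq> P"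
    using pull_vertices_lattice[OF \<tau>(1)] by blast
  have "x \<in> P \<inter> Q"
    using positive_combination_mem[OF \<tau>(2) conv sub] \<tau>(3) by blast
  then have "\<tau> \<subseteq> P \<inter> Q"
    using positive_combination_subset_face[OF \<tau>(2) pull_vertices_independent[OF \<tau>(1) conv] sub face(1) _ conv]
    by blast
  then have "pull_vertices r (P \<inter> Q) \<tau>"
    using pull_vertices_restrict[OF r(1) \<tau>(1) r(2) lat(1) face(1)] by blast
  then show ?thesis
    using pull_vertices_of_face[OF r(1,3) lat(2) face(2)] by blast
qed

context
  fixes C :: "(real ^ 'd) set set" and r :: "((real ^ 'd) \<times> (real ^ 'd)) set"
  assumes C: "polytopal_complex C" "\<forall>P\<in>C. lattice_polytope P" and r: "linear_order r"
begin

lemma pull_complex_transfer: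
  assumes "\<tau> \<in> pull_complex r C" "positive_combination \<tau> u x" "x \<in> Q" "Q \<in> C"
  shows "pull_vertices r Q \<tau>"
proof -
  obtain P where P: "P \<in> C" "pull_vertices r P \<tau>"
    using assms(1) unfolding pull_complex_def by blast
  show ?thesis
    by (rule pull_vertices_transfer[OF r, of P Q])
      (use P assms C in \<open>auto simp: polytopal_complex_def\<close>)
qed

lemma pull_complex_unique:
  assumes "\<tau> \<in> pull_complex r C" "positive_combination \<tau> u x"
    "\<sigma> \<in> pull_complex r C" "positive_combination \<sigma> u' x"
  shows "\<tau> = \<sigma>"
proof -
  obtain P where P: "P \<in> C" "pull_vertices r P \<tau>"
    using assms(1) unfolding pull_complex_def by blast
  then have "convex P"
    using C(2) polytope_imp_convex unfolding lattice_polytope_def by blast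
  then have "x \<in> P"
    using positive_combination_mem[OF assms(2)] pull_vertices_lattice[OF P(2)] by blast
  then have "pull_vertices r P \<sigma>"
    using pull_complex_transfer[OF assms(3,4)] P(1) by blast
  then show ?thesis
    using pull_vertices_unique[OF r P(2)] assms(2,4) C(2) P(1) by blast
qed

lemma pull_complex_carrier:
  assumes "D \<subseteq> C" "\<tau> \<in> pull_complex r D" "positive_combination \<tau> u x"
  shows "x \<in> \<Union>D"
proof -
  obtain P where P: "P \<in> D" "pull_vertices r P \<tau>"
    using assms(2) unfolding pull_complex_def by blast
  then have "convex P"
    using C(2) assms(1) polytope_imp_convex unfolding lattice_polytope_def by blast
  then have "x \<in> P"
    using positive_combination_mem[OF assms(3)] pull_vertices_lattice[OF P(2)] by blast
  then show ?thesis
    using P(1) by blast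
qed

lemma pull_complex_Diff_cover:
  assumes "D \<subseteq> C" "x \<in> \<Union>C - \<Union>D"
  obtains \<tau> u where "\<tau> \<in> pull_complex r C - pull_complex r D" "positive_combination \<tau> u x"
proof -
  obtain P where P: "P \<in> C" "x \<in> P"
    using assms(2) by blast
  obtain \<tau> u where \<tau>: "pull_vertices r P \<tau>" "positive_combination \<tau> u x"
    using pull_vertices_cover[OF r, of P x] P C(2) by blast
  moreover have "\<tau> \<notin> pull_complex r D"
    using pull_complex_carrier[OF assms(1) _ \<tau>(2)] assms(2) by blast
  ultimately show thesis
    using that P(1) unfolding pull_complex_def by blast
qed

text \<open>If the relative interior of \<tau> met some \<open>Q\<close> in \<open>D\<close>, then
  \<tau> would belong to the triangulation of \<open>Q\<close> by
  \<open>pull_complex_transfer\<close>.\<close>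

lemma pull_complex_Diff_carrier:
  assumes "D \<subseteq> C" "\<tau> \<in> pull_complex r C - pull_complex r D" "positive_combination \<tau> u x"
  shows "x \<in> \<Union>C - \<Union>D"
proof -
  have "x \<notin> Q" if "Q \<in> D" for Q
    using pull_complex_transfer[of \<tau> u x Q] assms that unfolding pull_complex_def by blast
  then show ?thesis
    using pull_complex_carrier[OF subset_refl _ assms(3)] assms(2) by blast
qed

end

lemma finite_lattice_points_complex:
  assumes "polytopal_complex C"
  shows "finite (\<Union>C \<inter> int_lattice)"
proof -
  have "bounded (\<Union>C)"
    using assms by (intro bounded_Union) (auto simp: polytopal_complex_def intro: polytope_imp_bounded)
  then show ?thesis
    by (rule finite_int_lattice_bounded)
qed

section \<open>Monomials as lattice points of dilates\<close>

definition monomial_point :: "('v \<Rightarrow> real ^ 'd) \<Rightarrow> ('v \<Rightarrow>\<^sub>0 nat) \<Rightarrow> real ^ 'd" where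
  "monomial_point g m =
     (\<Sum>i\<in>Poly_Mapping.keys m. real (Poly_Mapping.lookup m i) *\<^sub>R g i)"

text \<open>Exponents are positive exactly on the support and sum to the degree, so dividing by the
  degree gives barycentric coordinates. The inverse of \<open>g\<close> turns weights on variables
  into weights on points.\<close>

lemma monomial_point_positive_combination:
  assumes "inj_on g V" "Poly_Mapping.keys m \<subseteq> V" "monomial_degree m = k" "k > 0"
  shows "positive_combination (g ` Poly_Mapping.keys m)
    (\<lambda>w. real (Poly_Mapping.lookup m (the_inv_into V g w)) / real k) ((1 / real k) *\<^sub>R monomial_point g m)"
proof -
  let ?K = "Poly_Mapping.keys m"
  have inj: "inj_on g ?K" and inv: "\<And>i. i \<in> ?K \<Longrightarrow> the_inv_into V g (g i) = i"
    using assms(1,2) inj_on_subset the_inv_into_f_f[OF assms(1)] by blast+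
  have "real k = (\<Sum>i\<in>?K. real (Poly_Mapping.lookup m i))"
    using assms(3) unfolding monomial_degree_def by auto
  then have "(\<Sum>i\<in>?K. real (Poly_Mapping.lookup m i) / real k) = 1"
    using assms(4) by (simp flip: sum_divide_distrib)
  then show ?thesis
    unfolding positive_combination_def monomial_point_def
    using inv assms(4) by (auto simp: sum.reindex[OF inj] scaleR_sum_right in_keys_iff)
qed

text \<open>Injective because a point determines its carrier simplex and its coordinates there.
  Surjective because unimodularity makes the coordinates, scaled by \<open>k\<close>, integral, and
  they serve as exponents.\<close>

lemma monomial_point_lattice_bij:
  fixes C D :: "(real ^ 'd) set set" and g :: "'v \<Rightarrow> real ^ 'd"
  assumes C: "polytopal_complex C" "\<forall>P\<in>C. compressed P" and D: "D \<subseteq> C" and r: "linear_order r"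
    and g: "bij_betw g V (\<Union>C \<inter> int_lattice)" and k: "k > 0"
  shows "bij_betw (monomial_point g)
    {m. Poly_Mapping.keys m \<subseteq> V \<and> g ` Poly_Mapping.keys m \<in> pull_complex r C - pull_complex r D \<and>
        monomial_degree m = k}
    (int_lattice \<inter> (\<lambda>x. real k *\<^sub>R x) ` (\<Union>C - \<Union>D))"
    (is "bij_betw _ ?M ?L")
  unfolding bij_betw_def
proof (intro conjI)
  have lat: "\<forall>P\<in>C. lattice_polytope P"
    using C(2) unfolding compressed_def by blast
  have inj: "inj_on g V"
    using g by (rule bij_betw_imp_inj_on)
  have pc: "positive_combination (g ` Poly_Mapping.keys m)
    (\<lambda>w. real (Poly_Mapping.lookup m (the_inv_into V g w)) / real k) ((1 / real k) *\<^sub>R monomial_point g m)"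
    if "m \<in> ?M" for m
    using monomial_point_positive_combination[OF inj _ _ k] that by blast
  have ind: "\<not> affine_dependent \<tau>" if "\<tau> \<in> pull_complex r C" for \<tau>
    using that pull_vertices_independent lat polytope_imp_convex
    unfolding pull_complex_def lattice_polytope_def by blast
  show "inj_on (monomial_point g) ?M"
  proof (rule inj_onI)
    fix m m' assume m: "m \<in> ?M" "m' \<in> ?M" and eq: "monomial_point g m = monomial_point g m'"
    have "g ` Poly_Mapping.keys m = g ` Poly_Mapping.keys m'"
      using pull_complex_unique[OF C(1) lat r _ pc[OF m(1)] _ pc[OF m(2), folded eq]] m by blast
    then have keys: "Poly_Mapping.keys m = Poly_Mapping.keys m'"
      using inj_on_image_eq_iff[OF inj] m by blast
    show "m = m'"
    proof (rule poly_mapping_eqI)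
      fix i
      show "Poly_Mapping.lookup m i = Poly_Mapping.lookup m' i"
      proof (cases "i \<in> Poly_Mapping.keys m")
        case True
        then have "i \<in> V"
          using m by blast
        have "real (Poly_Mapping.lookup m (the_inv_into V g (g i))) / real k =
              real (Poly_Mapping.lookup m' (the_inv_into V g (g i))) / real k"
          using positive_combination_coefficients_unique[OF pc[OF m(1)] pc[OF m(2), folded eq keys] ind]
            m(1) True by blast
        then show ?thesis
          using k by (simp add: the_inv_into_f_f[OF inj \<open>i \<in> V\<close>])
      next
        case False
        then show ?thesis
          using keys by (metis in_keys_iff)
      qed
    qed
  qed
  show "monomial_point g ` ?M = ?L"
  proof (intro equalityI subsetI)
    fix y assume "y \<in> monomial_point g ` ?M"
    then obtain m where m: "m \<in> ?M" "y = monomial_point g m"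
      by blast
    have "(1 / real k) *\<^sub>R y \<in> \<Union>C - \<Union>D"
      using pull_complex_Diff_carrier[OF C(1) lat r D _ pc[OF m(1)]] m by blast
    moreover have "y = real k *\<^sub>R (1 / real k) *\<^sub>R y"
      using k by simp
    moreover have "g i \<in> int_lattice" if "i \<in> Poly_Mapping.keys m" for i
      using that m(1) g unfolding bij_betw_def by blast
    then have "y \<in> int_lattice"
      unfolding m(2) monomial_point_def int_lattice_def by (auto intro!: Ints_sum)
    ultimately show "y \<in> ?L"
      by blast
  next
    fix y assume y: "y \<in> ?L"
    then obtain x where x: "y = real k *\<^sub>R x" "x \<in> \<Union>C - \<Union>D"
      by blast
    obtain \<tau> u where \<tau>: "\<tau> \<in> pull_complex r C - pull_complex r D" "positive_combination \<tau> u x"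
      using pull_complex_Diff_cover[OF C(1) lat r D x(2)] .
    obtain P where P: "P \<in> C" "pull_vertices r P \<tau>"
      using \<tau>(1) unfolding pull_complex_def by blast
    have \<tau>_sub: "\<tau> \<subseteq> \<Union>C \<inter> int_lattice" and fin: "finite \<tau>"
      using pull_vertices_lattice[OF P(2)] P(1) by blast+
    have u_pos: "\<And>w. w \<in> \<tau> \<Longrightarrow> 0 < u w" and u_sum: "sum u \<tau> = 1" and ux: "(\<Sum>w\<in>\<tau>. u w *\<^sub>R w) = x"
      using \<tau>(2) unfolding positive_combination_def by blast+
    have int: "real k * u w \<in> \<int>" if "w \<in> \<tau>" for w
    proof (rule unimodular_simplex_integral_coordinates)
      show "unimodular_simplex (convex hull \<tau>)"
        using compressed_pull_vertices_unimodular[OF _ r _ P(2)] C(2) P(1) by blast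
      show "\<not> affine_dependent \<tau>"
        using ind \<tau>(1) by blast
      show "(\<Sum>w\<in>\<tau>. (real k * u w) *\<^sub>R w) \<in> int_lattice"
        using y ux x(1) by (simp flip: scaleR_scaleR scaleR_sum_right)
      show "(\<Sum>w\<in>\<tau>. real k * u w) \<in> \<int>"
        using u_sum by (simp flip: sum_distrib_left)
    qed (use \<tau>_sub that in auto)
    define s where "s = the_inv_into V g ` \<tau>"
    have gV: "g ` V = \<Union>C \<inter> int_lattice"
      using g unfolding bij_betw_def by blast
    have s: "s \<subseteq> V" "g ` s = \<tau>" "finite s"
      using the_inv_into_into[OF inj] f_the_inv_into_f[OF inj] \<tau>_sub fin unfolding s_def gV[symmetric]
      by (auto simp: image_image subset_iff)
    have inj_s: "inj_on g s"
      using inj s(1) inj_on_subset by blast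
    \<comment> \<open>The values \<open>real k * u (g i)\<close> on \<open>s\<close> are already
      positive integers; \<open>floor\<close> and \<open>nat\<close> only change their type.\<close>
    define m where "m = Abs_poly_mapping (\<lambda>i. if i \<in> s then nat \<lfloor>real k * u (g i)\<rfloor> else 0)"
    have lookup: "Poly_Mapping.lookup m = (\<lambda>i. if i \<in> s then nat \<lfloor>real k * u (g i)\<rfloor> else 0)"
      unfolding m_def by (rule Abs_poly_mapping_inverse) (use s(3) in simp)
    have real_lookup: "real (Poly_Mapping.lookup m i) = real k * u (g i)" if "i \<in> s" for i
    proof -
      have "g i \<in> \<tau>"
        using s(2) that by blast
      then have "real_of_int \<lfloor>real k * u (g i)\<rfloor> = real k * u (g i)" "0 < u (g i)"
        using int u_pos by simp_all
      then show ?thesis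
        using that by (simp add: lookup)
    qed
    have keys: "Poly_Mapping.keys m = s"
    proof -
      have "Poly_Mapping.lookup m i \<noteq> 0" if "i \<in> s" for i
      proof -
        have "0 < u (g i)"
          using u_pos s(2) that by blast
        then have "0 < real (Poly_Mapping.lookup m i)"
          unfolding real_lookup[OF that] using k by simp
        then show ?thesis by simp
      qed
      then show ?thesis
        by (auto simp: in_keys_iff lookup split: if_splits)
    qed
    have "real (monomial_degree m) = (\<Sum>i\<in>s. real k * u (g i))"
      unfolding monomial_degree_def keys by (simp add: real_lookup)
    also have "\<dots> = real k * sum u (g ` s)"
      by (simp add: sum.reindex[OF inj_s] sum_distrib_left)
    finally have deg: "monomial_degree m = k"
      using s(2) u_sum by simp
    have "monomial_point g m = (\<Sum>i\<in>s. (real k * u (g i)) *\<^sub>R g i)"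
      unfolding monomial_point_def keys by (simp add: real_lookup)
    also have "\<dots> = real k *\<^sub>R (\<Sum>w\<in>g ` s. u w *\<^sub>R w)"
      by (simp add: sum.reindex[OF inj_s] scaleR_sum_right)
    finally have "monomial_point g m = y"
      using s(2) ux x(1) by simp
    then show "y \<in> monomial_point g ` ?M"
      using deg keys s(1,2) \<tau>(1) by blast
  qed
qed

section \<open>Counting monomials\<close>

text \<open>Exponent vectors are multisets of variables, with degree as size; this reduces counting
  monomials to the known count of multisets.\<close>

lemma bij_betw_exponents_multisets:
  "bij_betw (\<lambda>u. Abs_multiset (Poly_Mapping.lookup u))
    {u. Poly_Mapping.keys u \<subseteq> V \<and> monomial_degree u = k} (multisets_of_size V k)"
proof (rule bij_betw_byWitness[where f' = "\<lambda>X. Abs_poly_mapping (count X)"])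
  have count: "count (Abs_multiset (Poly_Mapping.lookup u)) = Poly_Mapping.lookup u" for u :: "'a \<Rightarrow>\<^sub>0 nat"
    by (rule count_Abs_multiset) simp
  have lookup: "Poly_Mapping.lookup (Abs_poly_mapping (count X)) = count X" for X :: "'a multiset"
    by (rule Abs_poly_mapping_inverse) simp
  have keys: "Poly_Mapping.keys (Abs_poly_mapping (count X)) = set_mset X" for X :: "'a multiset"
    by (auto simp: in_keys_iff lookup simp flip: count_eq_zero_iff)
  have set: "set_mset (Abs_multiset (Poly_Mapping.lookup u)) = Poly_Mapping.keys u" for u :: "'a \<Rightarrow>\<^sub>0 nat"
    by (auto simp: in_keys_iff count set_mset_def)
  show "\<forall>u\<in>{u. Poly_Mapping.keys u \<subseteq> V \<and> monomial_degree u = k}.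
      Abs_poly_mapping (count (Abs_multiset (Poly_Mapping.lookup u))) = u"
    by (simp add: count)
  show "\<forall>X\<in>multisets_of_size V k. Abs_multiset (Poly_Mapping.lookup (Abs_poly_mapping (count X))) = X"
    by (simp add: lookup count_inverse)
  show "(\<lambda>u. Abs_multiset (Poly_Mapping.lookup u)) ` {u. Poly_Mapping.keys u \<subseteq> V \<and> monomial_degree u = k}
      \<subseteq> multisets_of_size V k"
    by (auto simp: multisets_of_size_def set size_multiset_overloaded_eq count monomial_degree_def)
  show "(\<lambda>X. Abs_poly_mapping (count X)) ` multisets_of_size V k
      \<subseteq> {u. Poly_Mapping.keys u \<subseteq> V \<and> monomial_degree u = k}"
    by (auto simp: multisets_of_size_def keys size_multiset_overloaded_eq lookup monomial_degree_def)
qed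

lemma finite_exponents:
  assumes "finite V"
  shows "finite {u. Poly_Mapping.keys u \<subseteq> V \<and> monomial_degree u = k}"
  using bij_betw_finite[OF bij_betw_exponents_multisets] finite_multisets_of_size[OF assms] by blast

lemma card_exponents:
  assumes "finite V"
  shows "card {u. Poly_Mapping.keys u \<subseteq> V \<and> monomial_degree u = k} = (card V + k - 1) choose k"
  using bij_betw_same_card[OF bij_betw_exponents_multisets] card_multisets_of_size[OF assms] by metis

section \<open>Polynomiality of the counts\<close>

text \<open>By absorption, raising \<open>m\<close> by one multiplies the binomial coefficient by
  \<open>(m + 1 + k) / (m + 1)\<close>, a linear factor in \<open>k\<close>.\<close>

lemma binomial_add_polynomial:
  "\<exists>p :: real poly. \<forall>k. real ((m + k) choose k) = poly p (real k)"
proof (induction m)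
  case 0
  show ?case
    by (intro exI[of _ 1]) simp
next
  case (Suc m)
  then obtain p :: "real poly" where p: "\<And>k. real ((m + k) choose k) = poly p (real k)"
    by blast
  have "real ((Suc m + k) choose k) = poly ([:1 / real (Suc m):] * p * [:real (Suc m), 1:]) (real k)" for k
  proof -
    have "Suc m * (Suc (m + k) choose Suc m) = Suc (m + k) * ((m + k) choose m)"
      by (rule Suc_times_binomial)
    moreover have "(Suc (m + k) choose Suc m) = (Suc m + k) choose k" "((m + k) choose m) = (m + k) choose k"
      using binomial_symmetric[of k "Suc m + k"] binomial_symmetric[of k "m + k"] by simp_all
    ultimately have "real (Suc m) * real ((Suc m + k) choose k) = real (Suc (m + k)) * real ((m + k) choose k)"
      by (metis of_nat_mult)
    then have "real ((Suc m + k) choose k) = (1 / real (Suc m)) * poly p (real k) * real (Suc (m + k))"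
      unfolding p by (simp add: field_simps)
    then show ?thesis
      by (simp add: algebra_simps add_divide_distrib)
  qed
  then show ?case by blast
qed

lemma poly_sum_exists:
  fixes f :: "'a \<Rightarrow> nat \<Rightarrow> real"
  assumes "finite S" "\<And>s. s \<in> S \<Longrightarrow> \<exists>p :: real poly. \<forall>k>0. f s k = poly p (real k)"
  shows "\<exists>p :: real poly. \<forall>k>0. (\<Sum>s\<in>S. f s k) = poly p (real k)"
proof -
  obtain p :: "'a \<Rightarrow> real poly" where "\<forall>s\<in>S. \<forall>k>0. f s k = poly (p s) (real k)"
    using assms(2) by metis
  then have "\<forall>k>0. (\<Sum>s\<in>S. f s k) = poly (sum p S) (real k)"
    by (simp add: poly_sum)
  then show ?thesis by blast
qed

lemma card_exponents_of_supports:
  assumes "finite S" "\<And>\<sigma>. \<sigma> \<in> S \<Longrightarrow> finite \<sigma>"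
  shows "card {u. Poly_Mapping.keys u \<in> S \<and> monomial_degree u = k} =
    (\<Sum>\<sigma>\<in>S. card {u. Poly_Mapping.keys u = \<sigma> \<and> monomial_degree u = k})"
proof -
  have "{u. Poly_Mapping.keys u \<in> S \<and> monomial_degree u = k} =
    (\<Union>\<sigma>\<in>S. {u. Poly_Mapping.keys u = \<sigma> \<and> monomial_degree u = k})"
    by blast
  moreover have "finite {u. Poly_Mapping.keys u = \<sigma> \<and> monomial_degree u = k}" if "\<sigma> \<in> S" for \<sigma>
    by (rule finite_subset[OF _ finite_exponents[OF assms(2)[OF that], of k]]) blast
  ultimately show ?thesis
    using card_UN_disjoint[OF assms(1), of "\<lambda>\<sigma>. {u. Poly_Mapping.keys u = \<sigma> \<and> monomial_degree u = k}"]
    by auto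
qed

text \<open>The exponents supported inside \<open>\<sigma>\<close> are counted by a binomial coefficient, from which the
  counts for the proper subsets of \<open>\<sigma>\<close> are subtracted.  The empty support
  contributes only at \<open>k = 0\<close>, which is why that value is excluded.\<close>

lemma card_exponents_of_support_polynomial:
  assumes "finite \<sigma>"
  shows "\<exists>p :: real poly. \<forall>k>0.
    real (card {u. Poly_Mapping.keys u = \<sigma> \<and> monomial_degree u = k}) = poly p (real k)"
  using assms
proof (induction rule: finite_psubset_induct)
  case (psubset \<sigma>)
  let ?N = "\<lambda>\<tau> k. card {u. Poly_Mapping.keys u = \<tau> \<and> monomial_degree u = k}"
  show ?case
  proof (cases "\<sigma> = {}")
    case True
    then have "?N \<sigma> k = 0" if "k > 0" for k
      using that by (auto simp: monomial_degree_def)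
    then show ?thesis
      by (intro exI[of _ 0]) simp
  next
    case False
    \<comment> \<open>Writing the cardinality as a successor turns
      \<open>card \<sigma> + k - 1\<close> from \<open>card_exponents\<close> into
      \<open>m + k\<close>, without truncated subtraction.\<close>
    obtain m where m: "card \<sigma> = Suc m"
      using False psubset.hyps by (metis card_eq_0_iff not0_implies_Suc)
    obtain p :: "real poly" where p: "\<forall>k. real ((m + k) choose k) = poly p (real k)"
      using binomial_add_polynomial by blast
    have "\<exists>p :: real poly. \<forall>k>0. (\<Sum>\<tau>\<in>Pow \<sigma> - {\<sigma>}. real (?N \<tau> k)) = poly p (real k)"
      by (rule poly_sum_exists) (use psubset in auto)
    then obtain q :: "real poly" where q: "\<forall>k>0. (\<Sum>\<tau>\<in>Pow \<sigma> - {\<sigma>}. real (?N \<tau> k)) = poly q (real k)"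
      by blast
    have "real (?N \<sigma> k) = poly (p - q) (real k)" if "k > 0" for k
    proof -
      have "(m + k) choose k = card {u. Poly_Mapping.keys u \<in> Pow \<sigma> \<and> monomial_degree u = k}"
        using card_exponents[OF psubset.hyps, of k] m by simp
      also have "\<dots> = (\<Sum>\<tau>\<in>Pow \<sigma>. ?N \<tau> k)"
        by (rule card_exponents_of_supports) (use psubset.hyps finite_subset in auto)
      also have "\<dots> = ?N \<sigma> k + (\<Sum>\<tau>\<in>Pow \<sigma> - {\<sigma>}. ?N \<tau> k)"
        by (rule sum.remove) (use psubset.hyps in auto)
      finally have "real ((m + k) choose k) = real (?N \<sigma> k) + (\<Sum>\<tau>\<in>Pow \<sigma> - {\<sigma>}. real (?N \<tau> k))"
        by simp
      then show ?thesis
        using p q that by simp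
    qed
    then show ?thesis by blast
  qed
qed

lemma card_exponents_of_supports_polynomial:
  assumes "finite S" "\<And>\<sigma>. \<sigma> \<in> S \<Longrightarrow> finite \<sigma>"
  shows "\<exists>p :: real poly. \<forall>k>0.
    real (card {u. Poly_Mapping.keys u \<in> S \<and> monomial_degree u = k}) = poly p (real k)"
proof -
  have "\<exists>p :: real poly.
    \<forall>k>0. (\<Sum>\<sigma>\<in>S. real (card {u. Poly_Mapping.keys u = \<sigma> \<and> monomial_degree u = k})) = poly p (real k)"
    by (rule poly_sum_exists[OF assms(1)]) (rule card_exponents_of_support_polynomial[OF assms(2)])
  then show ?thesis
    by (simp add: card_exponents_of_supports[OF assms])
qed

section \<open>Relative Stanley--Reisner ideals\<close>

lemma keys_add_nat:
  "Poly_Mapping.keys (a + b :: 'v \<Rightarrow>\<^sub>0 nat) = Poly_Mapping.keys a \<union> Poly_Mapping.keys b"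
  by (auto simp: in_keys_iff lookup_add)

lemma carrier_poly_ring:
  "carrier (poly_ring V) = {p. Poly_Mapping.keys p \<subseteq> {u. Poly_Mapping.keys u \<subseteq> V}}"
  by (auto simp: poly_ring_def)

lemma keys_mult_subset:
  fixes p q :: "('v, 'k::field) mpoly"
  assumes "Poly_Mapping.keys p \<subseteq> M" "Poly_Mapping.keys q \<subseteq> N" "\<And>a b. a \<in> M \<Longrightarrow> b \<in> N \<Longrightarrow> a + b \<in> L"
  shows "Poly_Mapping.keys (p * q) \<subseteq> L"
  using keys_mult[of p q] assms by blast

lemma poly_ring_cring: "cring (poly_ring V :: ('v, 'k::field) mpoly ring)"
proof (rule cringI)
  show "abelian_group (poly_ring V :: ('v, 'k) mpoly ring)"
  proof (rule abelian_groupI)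
    fix x y :: "('v, 'k) mpoly"
    assume "x \<in> carrier (poly_ring V)" "y \<in> carrier (poly_ring V)"
    then show "x \<oplus>\<^bsub>poly_ring V\<^esub> y \<in> carrier (poly_ring V)"
      using keys_add[of x y] by (auto simp: poly_ring_def)
  next
    fix x :: "('v, 'k) mpoly"
    assume "x \<in> carrier (poly_ring V)"
    then show "\<exists>y\<in>carrier (poly_ring V). y \<oplus>\<^bsub>poly_ring V\<^esub> x = \<zero>\<^bsub>poly_ring V\<^esub>"
      by (intro bexI[of _ "- x"]) (auto simp: poly_ring_def)
  qed (auto simp: poly_ring_def add.assoc add.commute)
  show "comm_monoid (poly_ring V :: ('v, 'k) mpoly ring)"
  proof (rule comm_monoidI)
    fix x y :: "('v, 'k) mpoly"
    assume "x \<in> carrier (poly_ring V)" "y \<in> carrier (poly_ring V)"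
    then show "x \<otimes>\<^bsub>poly_ring V\<^esub> y \<in> carrier (poly_ring V)"
      unfolding carrier_poly_ring mem_Collect_eq
      by (simp add: poly_ring_def) (erule (1) keys_mult_subset, simp add: keys_add_nat)
  qed (auto simp: poly_ring_def mult.assoc mult.commute)
qed (auto simp: poly_ring_def distrib_right)

lemma poly_ring_a_minus:
  fixes x y :: "('v, 'k::field) mpoly"
  assumes "x \<in> carrier (poly_ring V)" "y \<in> carrier (poly_ring V)"
  shows "x \<ominus>\<^bsub>poly_ring V\<^esub> y = x - y"
proof -
  interpret cring "poly_ring V :: ('v, 'k) mpoly ring"
    by (rule poly_ring_cring)
  have y: "- y \<in> carrier (poly_ring V)"
    using assms(2) by (simp add: carrier_poly_ring)
  have "- y \<oplus>\<^bsub>poly_ring V\<^esub> y = \<zero>\<^bsub>poly_ring V\<^esub>"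
    by (simp add: poly_ring_def)
  then have "\<ominus>\<^bsub>poly_ring V\<^esub> y = - y"
    using minus_equality assms(2) y by blast
  then show ?thesis
    unfolding a_minus_def by (simp add: poly_ring_def)
qed

text \<open>Peels off one term, for the inductions over sets of exponents in
  \<open>monomial_span_subset_ideal\<close> and \<open>dimension_SR_class_span\<close>.\<close>

lemma mpoly_split_key:
  fixes p :: "('v, 'k::field) mpoly"
  assumes "Poly_Mapping.keys p \<subseteq> insert u M"
  obtains q where "Poly_Mapping.keys q \<subseteq> M - {u}" "p = Poly_Mapping.single u (Poly_Mapping.lookup p u) + q"
proof
  let ?q = "p - Poly_Mapping.single u (Poly_Mapping.lookup p u)"
  show "Poly_Mapping.keys ?q \<subseteq> M - {u}"
    using assms by (auto simp: in_keys_iff lookup_minus lookup_single when_def split: if_splits)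
qed simp

text \<open>Constants belong to the ring, so an ideal that contains certain monomials contains all
  their linear combinations over the field.\<close>

lemma monomial_span_subset_ideal:
  fixes p :: "('v, 'k::field) mpoly"
  assumes I: "ideal I (poly_ring V)" and N: "N \<subseteq> {u. Poly_Mapping.keys u \<subseteq> V}" "monomial ` N \<subseteq> I"
    and p: "Poly_Mapping.keys p \<subseteq> N"
  shows "p \<in> I"
proof -
  interpret I: ideal I "poly_ring V" by (rule I)
  have "\<forall>p. Poly_Mapping.keys p \<subseteq> M \<longrightarrow> p \<in> I" if "finite M" "M \<subseteq> N" for M
    using that
  proof (induction M)
    case empty
    have "(0 :: ('v, 'k) mpoly) \<in> I"
      using I.additive_subgroup_axioms additive_subgroup.zero_closed by (fastforce simp: poly_ring_def)
    then show ?case by simp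
  next
    case (insert u M)
    show ?case
    proof (intro allI impI)
      fix p :: "('v, 'k) mpoly"
      assume "Poly_Mapping.keys p \<subseteq> insert u M"
      then obtain q where q: "Poly_Mapping.keys q \<subseteq> M - {u}"
        "p = Poly_Mapping.single u (Poly_Mapping.lookup p u) + q"
        by (rule mpoly_split_key)
      let ?c = "Poly_Mapping.single 0 (Poly_Mapping.lookup p u) :: ('v, 'k) mpoly"
      have "?c \<in> carrier (poly_ring V)"
        by (auto simp: poly_ring_def)
      then have "?c \<otimes>\<^bsub>poly_ring V\<^esub> monomial u \<in> I"
        using I.I_l_closed N(2) insert.prems by blast
      then have "Poly_Mapping.single u (Poly_Mapping.lookup p u) \<in> I"
        by (simp add: poly_ring_def monomial_def mult_single)
      moreover have "q \<in> I"
        using insert.IH insert.prems q(1) by blast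
      ultimately have "Poly_Mapping.single u (Poly_Mapping.lookup p u) \<oplus>\<^bsub>poly_ring V\<^esub> q \<in> I"
        using I.a_closed by blast
      then show "p \<in> I"
        using q(2) by (simp add: poly_ring_def)
    qed
  qed
  then show ?thesis
    using p finite_keys by blast
qed

text \<open>Every exponent of a product is a sum of exponents of the two factors, so upward closure
  of \<open>N\<close> is what absorption requires.\<close>

lemma monomial_span_ideal:
  fixes N :: "('v \<Rightarrow>\<^sub>0 nat) set"
  assumes N: "N \<subseteq> {u. Poly_Mapping.keys u \<subseteq> V}"
    and up: "\<And>a b. a \<in> N \<Longrightarrow> Poly_Mapping.keys b \<subseteq> V \<Longrightarrow> a + b \<in> N"
  shows "ideal {p :: ('v, 'k::field) mpoly. Poly_Mapping.keys p \<subseteq> N} (poly_ring V)"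
proof (rule idealI)
  interpret R: cring "poly_ring V :: ('v, 'k) mpoly ring"
    by (rule poly_ring_cring)
  let ?I = "{p :: ('v, 'k) mpoly. Poly_Mapping.keys p \<subseteq> N}"
  show "ring (poly_ring V :: ('v, 'k) mpoly ring)"
    by (rule R.ring_axioms)
  show "subgroup ?I (add_monoid (poly_ring V))"
  proof (rule group.subgroupI)
    show "group (add_monoid (poly_ring V :: ('v, 'k) mpoly ring))"
      by (rule R.add.is_group)
    show "?I \<subseteq> carrier (add_monoid (poly_ring V))"
      using N by (auto simp: carrier_poly_ring)
    have "0 \<in> ?I"
      by simp
    then show "?I \<noteq> {}"
      by (metis empty_iff)
  next
    fix a :: "('v, 'k) mpoly" assume a: "a \<in> ?I"
    have "a \<in> carrier (poly_ring V)"
      using a N by (auto simp: carrier_poly_ring)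
    then have "\<ominus>\<^bsub>poly_ring V\<^esub> a = - a"
      using poly_ring_a_minus[of 0 V a] R.minus_eq R.zero_closed R.l_zero R.a_inv_closed
      by (simp add: a_minus_def) (simp add: poly_ring_def)
    then show "inv\<^bsub>add_monoid (poly_ring V)\<^esub> a \<in> ?I"
      using a by (simp add: a_inv_def)
  next
    fix a b :: "('v, 'k) mpoly" assume "a \<in> ?I" "b \<in> ?I"
    then show "a \<otimes>\<^bsub>add_monoid (poly_ring V)\<^esub> b \<in> ?I"
      using keys_add[of a b] by (auto simp: poly_ring_def)
  qed
next
  fix a x :: "('v, 'k) mpoly"
  assume a: "a \<in> {p. Poly_Mapping.keys p \<subseteq> N}" and x: "x \<in> carrier (poly_ring V)"
  have "Poly_Mapping.keys (a * x) \<subseteq> N"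
    by (rule keys_mult_subset[of a N x "{u. Poly_Mapping.keys u \<subseteq> V}"])
      (use a x up in \<open>auto simp: carrier_poly_ring\<close>)
  then show "a \<otimes>\<^bsub>poly_ring V\<^esub> x \<in> {p. Poly_Mapping.keys p \<subseteq> N}"
    "x \<otimes>\<^bsub>poly_ring V\<^esub> a \<in> {p. Poly_Mapping.keys p \<subseteq> N}"
    by (simp_all add: poly_ring_def mult.commute)
qed

lemma genideal_monomials:
  fixes N :: "('v \<Rightarrow>\<^sub>0 nat) set"
  assumes N: "N \<subseteq> {u. Poly_Mapping.keys u \<subseteq> V}"
    and up: "\<And>a b. a \<in> N \<Longrightarrow> Poly_Mapping.keys b \<subseteq> V \<Longrightarrow> a + b \<in> N"
  shows "genideal (poly_ring V) (monomial ` N) = {p :: ('v, 'k::field) mpoly. Poly_Mapping.keys p \<subseteq> N}"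
proof
  interpret R: cring "poly_ring V :: ('v, 'k) mpoly ring"
    by (rule poly_ring_cring)
  have carr: "monomial ` N \<subseteq> carrier (poly_ring V :: ('v, 'k) mpoly ring)"
    using N by (auto simp: carrier_poly_ring monomial_def)
  show "genideal (poly_ring V) (monomial ` N) \<subseteq> {p :: ('v, 'k) mpoly. Poly_Mapping.keys p \<subseteq> N}"
    by (rule R.genideal_minimal[OF monomial_span_ideal[OF assms]]) (auto simp: monomial_def)
  show "{p :: ('v, 'k) mpoly. Poly_Mapping.keys p \<subseteq> N} \<subseteq> genideal (poly_ring V) (monomial ` N)"
    using monomial_span_subset_ideal[OF R.genideal_ideal[OF carr] N R.genideal_self[OF carr]] by blast
qed

definition nonface_exponents :: "'v set \<Rightarrow> 'v set set \<Rightarrow> ('v \<Rightarrow>\<^sub>0 nat) set" where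
  "nonface_exponents V \<Delta> = {u. Poly_Mapping.keys u \<subseteq> V \<and> Poly_Mapping.keys u \<notin> \<Delta>}"

lemma nonface_exponents_add:
  assumes "abstract_simplicial_complex V \<Delta>" "a \<in> nonface_exponents V \<Delta>" "Poly_Mapping.keys b \<subseteq> V"
  shows "a + b \<in> nonface_exponents V \<Delta>"
  using assms unfolding nonface_exponents_def abstract_simplicial_complex_def
  by (auto simp: keys_add_nat)

text \<open>Enlarging a non-face within \<open>V\<close> gives a non-face, so the non-face exponents
  are closed upward and \<open>genideal_monomials\<close> applies: membership is read off the
  exponents.\<close>

lemma SR_ideal_eq:
  assumes "abstract_simplicial_complex V \<Delta>"
  shows "SR_ideal V \<Delta> = {p :: ('v, 'k::field) mpoly. Poly_Mapping.keys p \<subseteq> nonface_exponents V \<Delta>}"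
    and "ideal (SR_ideal V \<Delta> :: ('v, 'k) mpoly set) (poly_ring V)"
proof -
  have sub: "nonface_exponents V \<Delta> \<subseteq> {u. Poly_Mapping.keys u \<subseteq> V}"
    by (auto simp: nonface_exponents_def)
  have gen: "{monomial u | u. Poly_Mapping.keys u \<subseteq> V \<and> Poly_Mapping.keys u \<notin> \<Delta>} =
    (monomial ` nonface_exponents V \<Delta> :: ('v, 'k) mpoly set)"
    by (auto simp: nonface_exponents_def)
  show eq: "SR_ideal V \<Delta> = {p :: ('v, 'k) mpoly. Poly_Mapping.keys p \<subseteq> nonface_exponents V \<Delta>}"
    unfolding SR_ideal_def gen by (rule genideal_monomials[OF sub nonface_exponents_add[OF assms]])
  show "ideal (SR_ideal V \<Delta> :: ('v, 'k) mpoly set) (poly_ring V)"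
    unfolding eq by (rule monomial_span_ideal[OF sub nonface_exponents_add[OF assms]])
qed

text \<open>The constants are the copy of the ground field whose image \<open>SR_scalars\<close>
  serves as base field for the dimension.\<close>

lemma single_zero_subfield:
  "subfield (range (Poly_Mapping.single 0)) (poly_ring V :: ('v, 'k::field) mpoly ring)"
proof -
  let ?K = "range (Poly_Mapping.single 0) :: ('v, 'k) mpoly set"
  interpret R: cring "poly_ring V :: ('v, 'k) mpoly ring"
    by (rule poly_ring_cring)
  have carr: "?K \<subseteq> carrier (poly_ring V)"
    by (auto simp: carrier_poly_ring split: if_splits)
  have "subring ?K (poly_ring V)"
  proof (rule R.subringI[OF carr])
    show "\<one>\<^bsub>poly_ring V\<^esub> \<in> ?K"
      by (rule range_eqI[of _ _ 1]) (simp add: poly_ring_def)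
  next
    fix h assume h: "h \<in> ?K"
    then have "\<zero>\<^bsub>poly_ring V\<^esub> \<ominus>\<^bsub>poly_ring V\<^esub> h = 0 - h"
      using poly_ring_a_minus[of 0 V h] carr by (auto simp: poly_ring_def)
    then have "\<ominus>\<^bsub>poly_ring V\<^esub> h = - h"
      using h carr by (simp add: R.minus_eq subset_iff)
    then show "\<ominus>\<^bsub>poly_ring V\<^esub> h \<in> ?K"
      using h by (auto simp flip: single_uminus)
  qed (auto simp: poly_ring_def mult_single split: if_splits simp flip: single_add)
  moreover have "Units (poly_ring V \<lparr>carrier := ?K\<rparr>) = ?K - {\<zero>\<^bsub>poly_ring V\<^esub>}"
  proof (intro equalityI subsetI)
    fix x assume "x \<in> Units (poly_ring V \<lparr>carrier := ?K\<rparr>)"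
    then show "x \<in> ?K - {\<zero>\<^bsub>poly_ring V\<^esub>}"
      by (auto simp: Units_def poly_ring_def)
  next
    fix x assume "x \<in> ?K - {\<zero>\<^bsub>poly_ring V\<^esub>}"
    then obtain c where c: "x = Poly_Mapping.single 0 c" and "x \<noteq> 0"
      by (auto simp: poly_ring_def)
    then have "c \<noteq> 0"
      by auto
    then have "Poly_Mapping.single 0 (inverse c) * x = 1" "x * Poly_Mapping.single 0 (inverse c) = 1"
      by (simp_all add: c mult_single)
    then show "x \<in> Units (poly_ring V \<lparr>carrier := ?K\<rparr>)"
      using c by (auto simp: Units_def poly_ring_def)
  qed
  ultimately show ?thesis
    using R.subfieldI R.subcringI' by blast
qed


lemma mpoly_restrict:
  fixes p :: "('v, 'k::field) mpoly"
  obtains q where "\<And>u. Poly_Mapping.lookup q u = (if P u then Poly_Mapping.lookup p u else 0)"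
proof
  have "finite {u. (if P u then Poly_Mapping.lookup p u else 0) \<noteq> 0}"
    by (rule finite_subset[OF _ finite_keys[of p]]) (auto simp: in_keys_iff)
  then show "Poly_Mapping.lookup (Abs_poly_mapping (\<lambda>u. if P u then Poly_Mapping.lookup p u else 0)) u =
    (if P u then Poly_Mapping.lookup p u else 0)" for u
    by (simp add: Abs_poly_mapping_inverse)
qed

section \<open>The Stanley-Reisner ring and graded parts of the relative ideal\<close>

context
  fixes V :: "'v set" and \<Delta> :: "'v set set"
  assumes \<Delta>: "abstract_simplicial_complex V \<Delta>"
begin

lemma SR_class_hom:
  "ring_hom_ring (poly_ring V) (SR_ring V \<Delta>) (SR_class V \<Delta> :: ('v, 'k::field) mpoly \<Rightarrow> _)"
proof -
  have "SR_class V \<Delta> = (\<lambda>p :: ('v, 'k) mpoly. SR_ideal V \<Delta> +>\<^bsub>poly_ring V\<^esub> p)"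
    by (rule ext) (rule SR_class_def)
  then show ?thesis
    using ideal.rcos_ring_hom_ring[OF SR_ideal_eq(2)[OF \<Delta>]] unfolding SR_ring_def by simp
qed

text \<open>The classes agree iff the difference has no term with face support. So the monomials
  supported on faces stay linearly independent in the quotient.\<close>

lemma SR_class_eq_iff:
  fixes p q :: "('v, 'k::field) mpoly"
  assumes "p \<in> carrier (poly_ring V)" "q \<in> carrier (poly_ring V)"
  shows "SR_class V \<Delta> p = SR_class V \<Delta> q \<longleftrightarrow>
    (\<forall>u. Poly_Mapping.keys u \<in> \<Delta> \<longrightarrow> Poly_Mapping.lookup p u = Poly_Mapping.lookup q u)"
proof -
  interpret R: cring "poly_ring V :: ('v, 'k) mpoly ring"
    by (rule poly_ring_cring)
  have "Poly_Mapping.keys (p - q) \<subseteq> {u. Poly_Mapping.keys u \<subseteq> V}"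
    using keys_diff[of p q] assms by (auto simp: carrier_poly_ring)
  then have "Poly_Mapping.keys (p - q) \<subseteq> nonface_exponents V \<Delta> \<longleftrightarrow>
    (\<forall>u. Poly_Mapping.keys u \<in> \<Delta> \<longrightarrow> Poly_Mapping.lookup p u = Poly_Mapping.lookup q u)"
    by (auto simp: nonface_exponents_def in_keys_iff lookup_minus subset_iff)
  moreover have "SR_class V \<Delta> p = SR_class V \<Delta> q \<longleftrightarrow> p - q \<in> SR_ideal V \<Delta>"
    using R.quotient_eq_iff_same_a_r_cos[OF SR_ideal_eq(2)[OF \<Delta>] assms] poly_ring_a_minus[OF assms]
    unfolding SR_class_def by simp
  ultimately show ?thesis
    unfolding SR_ideal_eq(1)[OF \<Delta>] by simp
qed

text \<open>The image of the monomial ideal under the quotient map is an ideal containing the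
  generators. Conversely, the preimage of the generated ideal is an ideal containing the monomials,
  hence their whole span.\<close>

lemma relative_SR_ideal_eq:
  assumes "abstract_simplicial_complex V \<Delta>'"
  shows "relative_SR_ideal V \<Delta> \<Delta>' =
    (SR_class V \<Delta> :: ('v, 'k::field) mpoly \<Rightarrow> _) ` {p. Poly_Mapping.keys p \<subseteq> nonface_exponents V \<Delta>'}"
    (is "_ = _ ` ?J")
proof
  interpret R: cring "poly_ring V :: ('v, 'k) mpoly ring"
    by (rule poly_ring_cring)
  interpret h: ring_hom_ring "poly_ring V" "SR_ring V \<Delta>" "SR_class V \<Delta> :: ('v, 'k) mpoly \<Rightarrow> _"
    by (rule SR_class_hom)
  have sub: "nonface_exponents V \<Delta>' \<subseteq> {u. Poly_Mapping.keys u \<subseteq> V}"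
    by (auto simp: nonface_exponents_def)
  have gen: "{SR_class V \<Delta> (monomial u) | u. Poly_Mapping.keys u \<subseteq> V \<and> Poly_Mapping.keys u \<notin> \<Delta>'} =
    (SR_class V \<Delta> :: ('v, 'k) mpoly \<Rightarrow> _) ` monomial ` nonface_exponents V \<Delta>'"
    by (auto simp: nonface_exponents_def)
  have mon: "monomial ` nonface_exponents V \<Delta>' \<subseteq> (carrier (poly_ring V) :: ('v, 'k) mpoly set)"
    using sub by (auto simp: carrier_poly_ring monomial_def)
  have carr: "(SR_class V \<Delta> :: ('v, 'k) mpoly \<Rightarrow> _) ` monomial ` nonface_exponents V \<Delta>' \<subseteq> carrier (SR_ring V \<Delta>)"
    using mon h.hom_closed by blast
  have idl: "ideal (SR_class V \<Delta> ` ?J) (SR_ring V \<Delta>)"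
  proof -
    have "SR_class V \<Delta> = (\<lambda>p :: ('v, 'k) mpoly. SR_ideal V \<Delta> +>\<^bsub>poly_ring V\<^esub> p)"
      by (rule ext) (rule SR_class_def)
    then show ?thesis
      using R.ring_ideal_imp_quot_ideal[OF SR_ideal_eq(2)[OF \<Delta>]
        monomial_span_ideal[OF sub nonface_exponents_add[OF assms]]] unfolding SR_ring_def by simp
  qed
  show "relative_SR_ideal V \<Delta> \<Delta>' \<subseteq> SR_class V \<Delta> ` ?J"
    unfolding relative_SR_ideal_def gen
  proof (rule h.S.genideal_minimal[OF idl])
    have "monomial ` nonface_exponents V \<Delta>' \<subseteq> ?J"
      by (auto simp: monomial_def)
    then show "SR_class V \<Delta> ` monomial ` nonface_exponents V \<Delta>' \<subseteq> SR_class V \<Delta> ` ?J"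
      by (rule image_mono)
  qed
  let ?I = "{p \<in> carrier (poly_ring V). SR_class V \<Delta> p \<in> relative_SR_ideal V \<Delta> \<Delta>'} :: ('v, 'k) mpoly set"
  have I: "ideal ?I (poly_ring V)"
    unfolding relative_SR_ideal_def gen by (rule h.ideal_vimage[OF h.S.genideal_ideal[OF carr]])
  have "monomial ` nonface_exponents V \<Delta>' \<subseteq> ?I"
    using mon h.S.genideal_self[OF carr] unfolding relative_SR_ideal_def gen by blast
  then have "?J \<subseteq> ?I"
    using monomial_span_subset_ideal[OF I sub] by blast
  then show "SR_class V \<Delta> ` ?J \<subseteq> relative_SR_ideal V \<Delta> \<Delta>'"
    by blast
qed

text \<open>Adding \<open>u\<close> to \<open>M\<close> extends the span by the line through the
  class of \<open>monomial u\<close>, which is new because classes remember their coefficients at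
  face exponents.\<close>

lemma dimension_SR_class_span:
  fixes M :: "('v \<Rightarrow>\<^sub>0 nat) set"
  assumes "finite M" "M \<subseteq> {u. Poly_Mapping.keys u \<in> \<Delta>}"
  shows "ring.dimension (SR_ring V \<Delta>) (card M) (SR_scalars V \<Delta>)
    ((SR_class V \<Delta> :: ('v, 'k::field) mpoly \<Rightarrow> _) ` {p. Poly_Mapping.keys p \<subseteq> M})"
  using assms
proof (induction M)
  interpret h: ring_hom_ring "poly_ring V" "SR_ring V \<Delta>" "SR_class V \<Delta> :: ('v, 'k) mpoly \<Rightarrow> _"
    by (rule SR_class_hom)
  {
    case empty
    have "SR_class V \<Delta> (0 :: ('v, 'k) mpoly) = \<zero>\<^bsub>SR_ring V \<Delta>\<^esub>"
      using h.hom_zero by (simp add: poly_ring_def)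
    then show ?case
      using h.S.dimension.zero_dim by (simp add: keys_eq_empty)
  next
    case (insert u M)
    have \<Delta>V: "Poly_Mapping.keys w \<subseteq> V" if "w \<in> insert u M" for w
      using that insert.prems \<Delta> unfolding abstract_simplicial_complex_def by blast
    have carr: "p \<in> carrier (poly_ring V)" if "Poly_Mapping.keys p \<subseteq> insert u M" for p :: "('v, 'k) mpoly"
      using that \<Delta>V by (auto simp: carrier_poly_ring)
    have mon: "monomial u \<in> (carrier (poly_ring V) :: ('v, 'k) mpoly set)"
      by (rule carr) (simp add: monomial_def)
    have const: "Poly_Mapping.single 0 c \<in> (carrier (poly_ring V) :: ('v, 'k) mpoly set)" for c
      by (simp add: carrier_poly_ring)
    let ?S = "\<lambda>M. SR_class V \<Delta> ` {p :: ('v, 'k) mpoly. Poly_Mapping.keys p \<subseteq> M}"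
    have class_split: "SR_class V \<Delta> (Poly_Mapping.single u c + q) =
      SR_class V \<Delta> (Poly_Mapping.single 0 c) \<otimes>\<^bsub>SR_ring V \<Delta>\<^esub> SR_class V \<Delta> (monomial u)
        \<oplus>\<^bsub>SR_ring V \<Delta>\<^esub> SR_class V \<Delta> q"
      if "Poly_Mapping.keys q \<subseteq> M" for c :: 'k and q
    proof -
      have q: "q \<in> carrier (poly_ring V)"
        using carr that by blast
      have "Poly_Mapping.single u c + q =
        Poly_Mapping.single 0 c \<otimes>\<^bsub>poly_ring V\<^esub> monomial u \<oplus>\<^bsub>poly_ring V\<^esub> q"
        by (simp add: poly_ring_def monomial_def mult_single)
      then show ?thesis
        using h.hom_add[OF h.R.m_closed[OF const mon] q] h.hom_mult[OF const mon] by simp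
    qed
    have "?S (insert u M) = h.S.line_extension (SR_scalars V \<Delta>) (SR_class V \<Delta> (monomial u)) (?S M)"
    proof (intro equalityI subsetI)
      fix x assume "x \<in> ?S (insert u M)"
      then obtain p :: "('v, 'k) mpoly" where p: "x = SR_class V \<Delta> p" "Poly_Mapping.keys p \<subseteq> insert u M"
        by blast
      from p(2) obtain q where q: "Poly_Mapping.keys q \<subseteq> M - {u}"
        "p = Poly_Mapping.single u (Poly_Mapping.lookup p u) + q"
        by (rule mpoly_split_key)
      then have "Poly_Mapping.keys q \<subseteq> M"
        by blast
      then show "x \<in> h.S.line_extension (SR_scalars V \<Delta>) (SR_class V \<Delta> (monomial u)) (?S M)"
        unfolding h.S.line_extension_mem_iff SR_scalars_def
        using class_split[of q "Poly_Mapping.lookup p u"] p(1) q(2) by auto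
    next
      fix x assume "x \<in> h.S.line_extension (SR_scalars V \<Delta>) (SR_class V \<Delta> (monomial u)) (?S M)"
      then obtain c and q :: "('v, 'k) mpoly" where q: "Poly_Mapping.keys q \<subseteq> M"
        "x = SR_class V \<Delta> (Poly_Mapping.single 0 c) \<otimes>\<^bsub>SR_ring V \<Delta>\<^esub> SR_class V \<Delta> (monomial u)
          \<oplus>\<^bsub>SR_ring V \<Delta>\<^esub> SR_class V \<Delta> q"
        unfolding h.S.line_extension_mem_iff SR_scalars_def by blast
      have "x = SR_class V \<Delta> (Poly_Mapping.single u c + q)"
        using class_split[OF q(1)] q(2) by simp
      moreover have "Poly_Mapping.keys (Poly_Mapping.single u c + q) \<subseteq> insert u M"
        using keys_add[of "Poly_Mapping.single u c" q] q(1) by (auto split: if_splits)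
      ultimately show "x \<in> ?S (insert u M)"
        by blast
    qed
    moreover have "SR_class V \<Delta> (monomial u) \<notin> ?S M"
    proof
      assume "SR_class V \<Delta> (monomial u) \<in> ?S M"
      then obtain q :: "('v, 'k) mpoly" where q: "Poly_Mapping.keys q \<subseteq> M"
        "SR_class V \<Delta> (monomial u) = SR_class V \<Delta> q"
        by blast
      have "q \<in> carrier (poly_ring V)"
        using carr q(1) by blast
      then have "Poly_Mapping.lookup q u = Poly_Mapping.lookup (monomial u) u"
        using q(2) SR_class_eq_iff[OF mon] insert.prems by simp
      then have "u \<in> Poly_Mapping.keys q"
        by (simp add: monomial_def in_keys_iff)
      then show False
        using q(1) insert.hyps(2) by blast
    qed
    moreover have "SR_class V \<Delta> (monomial u) \<in> carrier (SR_ring V \<Delta> :: ('v, 'k) mpoly set ring)"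
      using h.hom_closed[OF mon] .
    ultimately show ?case
      using h.S.dimension.Suc_dim[OF _ _ insert.IH] insert.prems insert.hyps by simp
  }
qed

lemma hilbert_function_relative_SR_ideal:
  assumes "finite V" "abstract_simplicial_complex V \<Delta>'" "{} \<in> \<Delta>"
  shows "hilbert_function V \<Delta> (relative_SR_ideal V \<Delta> \<Delta>' :: ('v, 'k::field) mpoly set set) k =
    card {u. Poly_Mapping.keys u \<in> \<Delta> - \<Delta>' \<and> monomial_degree u = k}"
proof -
  interpret h: ring_hom_ring "poly_ring V" "SR_ring V \<Delta>" "SR_class V \<Delta> :: ('v, 'k) mpoly \<Rightarrow> _"
    by (rule SR_class_hom)
  let ?M = "{u. Poly_Mapping.keys u \<in> \<Delta> - \<Delta>' \<and> monomial_degree u = k}"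
  have \<Delta>V: "\<sigma> \<subseteq> V" if "\<sigma> \<in> \<Delta>" for \<sigma>
    using that \<Delta> unfolding abstract_simplicial_complex_def by blast
  have "relative_SR_ideal V \<Delta> \<Delta>' \<inter> SR_graded_part V \<Delta> k =
    (SR_class V \<Delta> :: ('v, 'k) mpoly \<Rightarrow> _) ` {p. Poly_Mapping.keys p \<subseteq> ?M}"
  proof (intro equalityI subsetI)
    fix x :: "('v, 'k) mpoly set"
    assume "x \<in> relative_SR_ideal V \<Delta> \<Delta>' \<inter> SR_graded_part V \<Delta> k"
    then obtain p q where p: "x = SR_class V \<Delta> p" "Poly_Mapping.keys p \<subseteq> nonface_exponents V \<Delta>'"
      and q: "x = SR_class V \<Delta> q" "q \<in> carrier (poly_ring V)" "\<forall>u\<in>Poly_Mapping.keys q. monomial_degree u = k"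
      unfolding relative_SR_ideal_eq[OF assms(2)] SR_graded_part_def by blast
    have pc: "p \<in> carrier (poly_ring V)"
      using p(2) by (auto simp: carrier_poly_ring nonface_exponents_def)
    \<comment> \<open>One class has a representative \<open>p\<close> in the monomial ideal of
      \<Delta>' and another, \<open>q\<close>, homogeneous of degree \<open>k\<close>. They agree at
      face exponents, so dropping the non-face terms of \<open>q\<close> leaves terms that satisfy
      both conditions.\<close>
    obtain q' where q': "\<And>u. Poly_Mapping.lookup q' u =
      (if Poly_Mapping.keys u \<in> \<Delta> then Poly_Mapping.lookup q u else 0)"
      using mpoly_restrict[of "\<lambda>u. Poly_Mapping.keys u \<in> \<Delta>" q] by blast
    have q'_keys: "u \<in> Poly_Mapping.keys q' \<longleftrightarrow> Poly_Mapping.keys u \<in> \<Delta> \<and> u \<in> Poly_Mapping.keys q" for u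
      by (simp add: in_keys_iff q')
    have "q' \<in> carrier (poly_ring V)"
      using q(2) q'_keys by (auto simp: carrier_poly_ring)
    then have "x = SR_class V \<Delta> q'"
      using SR_class_eq_iff[OF q(2)] q(1) q' by simp
    moreover have "Poly_Mapping.keys q' \<subseteq> ?M"
    proof
      fix u assume u: "u \<in> Poly_Mapping.keys q'"
      have "Poly_Mapping.lookup p u = Poly_Mapping.lookup q u"
        using SR_class_eq_iff[OF pc q(2)] p(1) q(1) u q'_keys by simp
      then have "u \<in> Poly_Mapping.keys p"
        using u q'_keys by (simp add: in_keys_iff)
      then show "u \<in> ?M"
        using u p(2) q(3) q'_keys by (auto simp: nonface_exponents_def)
    qed
    ultimately show "x \<in> SR_class V \<Delta> ` {p. Poly_Mapping.keys p \<subseteq> ?M}"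
      by blast
  next
    fix x :: "('v, 'k) mpoly set"
    assume "x \<in> SR_class V \<Delta> ` {p. Poly_Mapping.keys p \<subseteq> ?M}"
    then obtain p where p: "x = SR_class V \<Delta> p" "Poly_Mapping.keys p \<subseteq> ?M"
      by blast
    have "Poly_Mapping.keys p \<subseteq> nonface_exponents V \<Delta>'" "p \<in> carrier (poly_ring V)"
      "\<forall>u\<in>Poly_Mapping.keys p. monomial_degree u = k"
      using p(2) \<Delta>V by (auto simp: nonface_exponents_def carrier_poly_ring)
    then show "x \<in> relative_SR_ideal V \<Delta> \<Delta>' \<inter> SR_graded_part V \<Delta> k"
      unfolding relative_SR_ideal_eq[OF assms(2)] SR_graded_part_def using p(1) by blast
  qed
  moreover have "finite ?M"
    by (rule finite_subset[OF _ finite_exponents[OF assms(1), of k]]) (use \<Delta>V in blast)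
  moreover have "subfield (SR_scalars V \<Delta>) (SR_ring V \<Delta> :: ('v, 'k) mpoly set ring)"
  proof -
    \<comment> \<open>The empty face keeps 1 out of the ideal, so the quotient is not the zero ring
      and the constants map onto a subfield.\<close>
    have "SR_class V \<Delta> (1 :: ('v, 'k) mpoly) \<noteq> SR_class V \<Delta> 0"
    proof
      assume eq: "SR_class V \<Delta> (1 :: ('v, 'k) mpoly) = SR_class V \<Delta> 0"
      have carr: "1 \<in> (carrier (poly_ring V) :: ('v, 'k) mpoly set)"
        "0 \<in> (carrier (poly_ring V) :: ('v, 'k) mpoly set)"
        by (simp_all add: carrier_poly_ring)
      have "Poly_Mapping.keys (0 :: 'v \<Rightarrow>\<^sub>0 nat) \<in> \<Delta>"
        using assms(3) by simp
      then have "Poly_Mapping.lookup (1 :: ('v, 'k) mpoly) 0 = Poly_Mapping.lookup (0 :: ('v, 'k) mpoly) 0"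
        using iffD1[OF SR_class_eq_iff[OF carr] eq] by metis
      then show False
        by simp
    qed
    then have "\<one>\<^bsub>SR_ring V \<Delta>\<^esub> \<noteq> (\<zero>\<^bsub>SR_ring V \<Delta>\<^esub> :: ('v, 'k) mpoly set)"
      using h.hom_one h.hom_zero by (simp add: poly_ring_def)
    moreover have "SR_scalars V \<Delta> = (SR_class V \<Delta> :: ('v, 'k) mpoly \<Rightarrow> _) ` range (Poly_Mapping.single 0)"
      by (auto simp: SR_scalars_def)
    ultimately show ?thesis
      using h.img_is_subfield(2)[OF single_zero_subfield] by simp
  qed
  ultimately show ?thesis
    unfolding hilbert_function_def
    using h.S.dimI[OF _ dimension_SR_class_span[of ?M]] by (auto simp: over_def)
qed

end

section \<open>Ehrhart and Hilbert functions\<close>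

text \<open>The empty face is always included, since the Stanley--Reisner ring of the empty family is zero and
  has no field of scalars.\<close>

definition vertex_complex ::
    "('v \<Rightarrow> real ^ 'd) \<Rightarrow> 'v set \<Rightarrow> (real ^ 'd) set set \<Rightarrow> 'v set set" where
  "vertex_complex g V T = {\<sigma>. \<sigma> \<subseteq> V \<and> g ` \<sigma> \<in> insert {} T}"

lemma vertex_complex_simplicial:
  "abstract_simplicial_complex V (vertex_complex g V (pull_complex r C))"
  unfolding abstract_simplicial_complex_def
proof (intro conjI ballI allI impI)
  fix \<sigma> \<tau> assume \<sigma>: "\<sigma> \<in> vertex_complex g V (pull_complex r C)" "\<tau> \<subseteq> \<sigma>"
  show "\<tau> \<in> vertex_complex g V (pull_complex r C)"
  proof (cases "g ` \<sigma> = {}")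
    case False
    then obtain P where P: "P \<in> C" "pull_vertices r P (g ` \<sigma>)"
      using \<sigma>(1) unfolding vertex_complex_def pull_complex_def by blast
    have "pull_vertices r P (g ` \<tau>)"
      using P(2) image_mono[OF \<sigma>(2)] by (rule pull_vertices_subset)
    then have "g ` \<tau> \<in> pull_complex r C"
      using P(1) unfolding pull_complex_def by blast
    then show ?thesis
      using \<sigma> unfolding vertex_complex_def by blast
  qed (use \<sigma> in \<open>auto simp: vertex_complex_def\<close>)
qed (auto simp: vertex_complex_def)

theorem theorem5:
  fixes C C' :: "(real ^ 'd) set set"
  assumes "polytopal_complex C"
    and "\<forall>P\<in>C. compressed P"
    and "subcomplex C' C"
  shows "\<exists>(V :: nat set) \<Delta> \<Delta>'.
    finite V \<and>
    abstract_simplicial_complex V \<Delta> \<and> abstract_simplicial_complex V \<Delta>' \<and> \<Delta>' \<subseteq> \<Delta> \<and>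
    (\<forall>k>0. ehrhart (\<Union>C - \<Union>C') k =
       hilbert_function V \<Delta> (relative_SR_ideal V \<Delta> \<Delta>' :: (nat, 'k::field) mpoly set set) k) \<and>
    (\<exists>p :: real poly. \<forall>k>0. real (ehrhart (\<Union>C - \<Union>C') k) = poly p (real k))"
proof -
  have C': "C' \<subseteq> C"
    using assms(3) unfolding subcomplex_def by blast
  \<comment> \<open>A well-order of the whole space supplies one linear order for all members of
    \<open>C\<close> at once, which makes their triangulations compatible.\<close>
  obtain r :: "((real ^ 'd) \<times> (real ^ 'd)) set" where r: "linear_order r"
    using well_order_on[of UNIV] unfolding well_order_on_def by blast
  define V where "V = {0..<card (\<Union>C \<inter> int_lattice)}"
  obtain g where g: "bij_betw g V (\<Union>C \<inter> int_lattice)"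
    using ex_bij_betw_nat_finite[OF finite_lattice_points_complex[OF assms(1)]] unfolding V_def by blast
  let ?\<Delta> = "\<lambda>D. vertex_complex g V (pull_complex r D)"
  have fin: "finite V"
    by (simp add: V_def)
  have sub: "?\<Delta> C' \<subseteq> ?\<Delta> C"
    using C' unfolding vertex_complex_def pull_complex_def by blast
  have ehrhart: "ehrhart (\<Union>C - \<Union>C') k =
    card {u. Poly_Mapping.keys u \<in> ?\<Delta> C - ?\<Delta> C' \<and> monomial_degree u = k}" if k: "k > 0" for k
  proof -
    \<comment> \<open>Positive degree means nonempty support, so the empty face added in
      \<open>vertex_complex\<close> does not affect the count.\<close>
    have "Poly_Mapping.keys u \<noteq> {}" if "monomial_degree u = k" for u :: "nat \<Rightarrow>\<^sub>0 nat"
      using that k by (auto simp: monomial_degree_def)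
    then have "{u. Poly_Mapping.keys u \<in> ?\<Delta> C - ?\<Delta> C' \<and> monomial_degree u = k} =
      {m. Poly_Mapping.keys m \<subseteq> V \<and> g ` Poly_Mapping.keys m \<in> pull_complex r C - pull_complex r C' \<and>
        monomial_degree m = k}"
      unfolding vertex_complex_def by auto
    then show ?thesis
      using bij_betw_same_card[OF monomial_point_lattice_bij[OF assms(1,2) C' r g k]]
      unfolding ehrhart_def by simp
  qed
  have hilbert: "hilbert_function V (?\<Delta> C) (relative_SR_ideal V (?\<Delta> C) (?\<Delta> C') :: (nat, 'k) mpoly set set) k =
    card {u. Poly_Mapping.keys u \<in> ?\<Delta> C - ?\<Delta> C' \<and> monomial_degree u = k}" for k
    by (rule hilbert_function_relative_SR_ideal[OF vertex_complex_simplicial fin vertex_complex_simplicial])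
      (simp add: vertex_complex_def)
  have "finite (?\<Delta> C - ?\<Delta> C')" "\<And>\<sigma>. \<sigma> \<in> ?\<Delta> C - ?\<Delta> C' \<Longrightarrow> finite \<sigma>"
    using fin finite_subset[of _ V] finite_subset[of "?\<Delta> C - ?\<Delta> C'" "Pow V"]
    unfolding vertex_complex_def by auto
  from card_exponents_of_supports_polynomial[OF this] obtain p :: "real poly" where
    "\<forall>k>0. real (card {u. Poly_Mapping.keys u \<in> ?\<Delta> C - ?\<Delta> C' \<and> monomial_degree u = k}) = poly p (real k)"
    by blast
  then have polynomial: "\<exists>p :: real poly. \<forall>k>0. real (ehrhart (\<Union>C - \<Union>C') k) = poly p (real k)"
    by (intro exI[of _ p]) (simp add: ehrhart)
  have "\<forall>k>0. ehrhart (\<Union>C - \<Union>C') k =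
    hilbert_function V (?\<Delta> C) (relative_SR_ideal V (?\<Delta> C) (?\<Delta> C') :: (nat, 'k) mpoly set set) k"
    using ehrhart hilbert by simp
  then show ?thesis
    by (intro exI[of _ V] exI[of _ "?\<Delta> C"] exI[of _ "?\<Delta> C'"] conjI
        fin vertex_complex_simplicial sub polynomial)
qed

end
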